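(* Let $(\tau,p)$ be an unbounded probabilistic context tree on a countable alphabet $A$, let $0<\epsilon<1$, and suppose that $(\tau,p)$ has an $\epsilon$-regular reference string $w$ with associated function $\ell^{w}:\mathbb{N}\to\mathbb{N}$ satisfying $$\limsup_{k\to\infty}\frac{\log(\ell^{w}(k))}{C_{\epsilon}\,k}<1,\qquad C_{\epsilon}:=-\frac{1}{|w|}\log\bigl(1-\epsilon^{|w|}\bigr)>0 .$$ Let $\mathbf{X}=X(\mathbf{U})$ be the chain constructed from the i.i.d. uniform sequence $\mathbf{U}$. Then $\mathbf{X}$ has a regeneration scheme, i.e. the chain $\boldsymbol{\xi}=(\xi_j)_{j\in\mathbb{Z}}$, $\xi_j:=\mathbf{1}\{\theta[j,+\infty]=j\}$, is renewal. Moreover, if $(T_i)_{i\in\mathbb{Z}}$ is the sequence of times with $T_i<T_{i+1}$, $T_0\le 0<T_1$ and $\{j:\xi_j=1\}=\{T_i:i\in\mathbb{Z}\}$, then the random strings $([X(\mathbf{U})]_{T_i},\ldots,[X(\mathbf{U})]_{T_{i+1}-1})_{i\ne 0}$ are i.i.d. and have finite expected size (length).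
   Context: Strings: $\mathbb{N}=\{0,1,2,\ldots\}$. For a countable alphabet $A$, $a_m^n$ denotes the string $a_m\ldots a_n$, of length $n-m+1$ (with $a_{n+1}^n=\emptyset$). $A^{-\mathbb{N}}=A^{\{\ldots,-2,-1\}}$ is the set of infinite pasts and $A^\star=\bigcup_{j\ge 0}A^{\{-j,\ldots,-1\}}$ the set of finite strings (including the empty string $\emptyset$). A string $s$ is a suffix of $v$ if $|s|\le|v|$ and $v_{-|s|}^{-1}=s$. Context trees: A tree is a subset $\tau\subset A^\star\cup A^{-\mathbb{N}}$ in which no string is a suffix of another string; it is unbounded if $\sup\{|v|:v\in\tau\}=+\infty$; it is complete (a context tree) if every $a_{-\infty}^{-1}\in A^{-\mathbb{N}}$ has a (necessarily unique) suffix in $\tau$, called its context $c_\tau(a_{-\infty}^{-1})$. For a finite string $a_m^n$, $c_\tau(a_m^n)$ is its suffix belonging to $\tau$ if there is one, and $c_\tau(a_m^n)=\emptyset$ otherwise. A probabilistic context tree $(\tau,p)$ is a context tree $\tau$ with a family $p=\{p(\cdot|v):v\in\tau\}$ of probability distributions on $A$. $\epsilon$-regularity: $a\in A$ is $\epsilon$-regular if $\inf_{v\in\tau}p(a|v)\ge\epsilon$; a finite string is $\epsilon$-regular if all symbols appearing in it are. $\mathcal{E}$ is the (finite) set of $\epsilon$-regular symbols, and $\#\mathcal{E}$ its cardinality. Symbols are labelled so that $A=\{1,2,\ldots\}$ and $\mathcal{E}=\{1,\ldots,\#\mathcal{E}\}$. Reference string: for a nonempty finite string $w$ and $v\in\tau$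 let $m^w(v)=\inf\{j:0\le j\le|v|-|w|,\ v_{-j-|w|}^{-j-1}=w\}$, with $m^w(v)=+\infty$ if there is no such $j$. $w$ is a reference string of $\tau$ with function $\ell^w:\mathbb{N}\to\mathbb{N}$ (finite valued) if $|v|=m^w(v)+|w|+\ell^w(m^w(v))$ for every $v\in\tau$ (so $|v|=+\infty$ exactly when $m^w(v)=+\infty$). Convention: $\log 0=-\infty$. Construction: for $v\in\tau$ and $a\in\mathcal{E}$ let $J(a|\emptyset)=[(a-1)\epsilon,a\epsilon[$, $J(a|v)=\bigl[\#\mathcal{E}\epsilon+\sum_{i=1}^{a-1}(p(i|v)-\epsilon),\ \#\mathcal{E}\epsilon+\sum_{i=1}^{a}(p(i|v)-\epsilon)\bigr[$ and $K(a|v)=J(a|\emptyset)\cup J(a|v)$; for $a\in A\setminus\mathcal{E}$ let $K(a|v)=J(a|v)=\bigl[\sum_{i=1}^{a-1}p(i|v),\sum_{i=1}^{a}p(i|v)\bigr[$. Let $\mathbf{U}=(U_n)_{n\in\mathbb{Z}}$ be i.i.d. uniform on $[0,1[$ under $\mathbb{P}$. The update function $F(u,s)\in A\cup\{\star\}$, for $u\in[0,1[$ and a string $s$ (finite or infinite), is: if $c_\tau(s)\ne\emptyset$, $F(u,s)=a$ for the unique $a\in A$ with $u\in K(a|c_\tau(s))$; if $c_\tau(s)=\emptyset$, $F(u,s)=a$ when $u\in J(a|\emptyset)$, $a\in\mathcal{E}$, and $F(u,s)=\star$ when $u\in[\#\mathcal{E}\epsilon,1[$. For $m\le n\le+\infty$,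 $\mathcal{L}(U_m^n)\in\{0,1\}$ equals $1$ if and only if there is a string $a_m^n$ of symbols of $A$ with $F(U_i,a_m^{i-1})=a_i$ for all $i$ with $m\le i\le n$ ($i<\infty$). Put $\theta[m,n]:=\max\{k\le m:\mathcal{L}(U_k^n)=1\}$ (equal to $-\infty$ if there is no such $k$). Under the hypotheses of the claim, $\theta[m,n]>-\infty$ almost surely for all $m\le n\le+\infty$. The chain $X(\mathbf{U})$: for a window $[m,n]$, with $k=\theta[m,n]$, put recursively $[X(\mathbf{U})]_i=F(U_i,[X(\mathbf{U})]_k^{i-1})$, $i=k,\ldots,n$. Values computed for different windows agree wherever they are both defined, so this defines almost surely a chain $X(\mathbf{U})=([X(\mathbf{U})]_n)_{n\in\mathbb{Z}}$ with values in $A$; it is the unique stationary chain compatible with $(\tau,p)$. Renewal: the $\{0,1\}$-valued chain $\boldsymbol{\xi}$ is renewal if, with $(T_i)_{i\in\mathbb{Z}}$ the increasing enumeration of its $1$'s normalized by $T_0\le 0<T_1$, the increments $(T_{i+1}-T_i)_{i\in\mathbb{Z}}$ are independent, and are identically distributed for $i\ne 0$. *)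

theory Defs
  imports "HOL-Probability.Probability" "HOL-Library.Extended"
begin

section \<open>Strings and context trees\<close>

text \<open>
  A string that ends at time \<open>-1\<close>: either finite, as a list written from left to right, or an
  infinite past \<open>x\<close>, where \<open>x j\<close> is the symbol at time \<open>-j-1\<close>.
\<close>

datatype 'a str = Finite "'a list" | Infinite "nat \<Rightarrow> 'a"

fun slen :: "'a str \<Rightarrow> enat" where
  "slen (Finite s) = enat (length s)"
| "slen (Infinite x) = \<infinity>"

text \<open>\<open>sym v j\<close> is the symbol of \<open>v\<close> at time \<open>-j-1\<close>; it is meaningful only for \<open>j < slen v\<close>.\<close>

fun sym :: "'a str \<Rightarrow> nat \<Rightarrow> 'a" where
  "sym (Finite s) j = rev s ! j"
| "sym (Infinite x) j = x j"

definition is_suffix :: "'a str \<Rightarrow> 'a str \<Rightarrow> bool" where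
  "is_suffix s v \<longleftrightarrow> slen s \<le> slen v \<and> (\<forall>j. enat j < slen s \<longrightarrow> sym v j = sym s j)"

definition finite_strings :: "'a set \<Rightarrow> 'a str set" where
  "finite_strings A = {Finite s | s. set s \<subseteq> A}"

definition infinite_pasts :: "'a set \<Rightarrow> 'a str set" where
  "infinite_pasts A = {Infinite x | x. range x \<subseteq> A}"

definition tree :: "'a set \<Rightarrow> 'a str set \<Rightarrow> bool" where
  "tree A \<tau> \<longleftrightarrow> \<tau> \<subseteq> finite_strings A \<union> infinite_pasts A \<and>
     (\<forall>s\<in>\<tau>. \<forall>v\<in>\<tau>. is_suffix s v \<longrightarrow> s = v)"

definition unbounded_tree :: "'a str set \<Rightarrow> bool" where
  "unbounded_tree \<tau> \<longleftrightarrow> (SUP v\<in>\<tau>. slen v) = \<infinity>"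

definition context_tree :: "'a set \<Rightarrow> 'a str set \<Rightarrow> bool" where
  "context_tree A \<tau> \<longleftrightarrow> tree A \<tau> \<and> (\<forall>x\<in>infinite_pasts A. \<exists>v\<in>\<tau>. is_suffix v x)"

definition ctx :: "'a str set \<Rightarrow> 'a str \<Rightarrow> 'a str" where
  "ctx \<tau> s = (if \<exists>v\<in>\<tau>. is_suffix v s then THE v. v \<in> \<tau> \<and> is_suffix v s else Finite [])"

text \<open>\<open>pmf (p v) a\<close> is the probability \<open>p(a|v)\<close>.\<close>

definition prob_context_tree :: "'a set \<Rightarrow> 'a str set \<Rightarrow> ('a str \<Rightarrow> 'a pmf) \<Rightarrow> bool" where
  "prob_context_tree A \<tau> p \<longleftrightarrow> context_tree A \<tau> \<and> (\<forall>v\<in>\<tau>. set_pmf (p v) \<subseteq> A)"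

section \<open>Regular symbols and reference strings\<close>

definition regular_symbols ::
    "'a set \<Rightarrow> 'a str set \<Rightarrow> ('a str \<Rightarrow> 'a pmf) \<Rightarrow> real \<Rightarrow> 'a set" where
  "regular_symbols A \<tau> p \<epsilon> = {a \<in> A. (INF v\<in>\<tau>. pmf (p v) a) \<ge> \<epsilon>}"

definition regular_string ::
    "'a set \<Rightarrow> 'a str set \<Rightarrow> ('a str \<Rightarrow> 'a pmf) \<Rightarrow> real \<Rightarrow> 'a list \<Rightarrow> bool" where
  "regular_string A \<tau> p \<epsilon> w \<longleftrightarrow> set w \<subseteq> regular_symbols A \<tau> p \<epsilon>"

text \<open>\<open>substr v j n\<close> is the string of the symbols of \<open>v\<close> at the times \<open>-j-n, \<dots>, -j-1\<close>.\<close>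

definition substr :: "'a str \<Rightarrow> nat \<Rightarrow> nat \<Rightarrow> 'a list" where
  "substr v j n = map (sym v) (rev [j..<j + n])"

definition first_occ :: "'a list \<Rightarrow> 'a str \<Rightarrow> enat" where
  "first_occ w v =
     Inf {enat j | j. enat (j + length w) \<le> slen v \<and> substr v j (length w) = w}"

definition reference_string :: "'a str set \<Rightarrow> 'a list \<Rightarrow> (nat \<Rightarrow> nat) \<Rightarrow> bool" where
  "reference_string \<tau> w l \<longleftrightarrow> w \<noteq> [] \<and>
     (\<forall>v\<in>\<tau>. slen v = (case first_occ w v of enat m \<Rightarrow> enat (m + length w + l m) | \<infinity> \<Rightarrow> \<infinity>))"

definition elog :: "nat \<Rightarrow> ereal" where
  "elog n = (if n = 0 then - \<infinity> else ereal (ln (real n)))"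

definition C_const :: "real \<Rightarrow> 'a list \<Rightarrow> real" where
  "C_const \<epsilon> w = - (1 / real (length w)) * ln (1 - \<epsilon> ^ length w)"

section \<open>The update function\<close>

text \<open>
  From here on the symbols are labelled by positive natural numbers, the regular ones first.
  The alphabet may be finite.
\<close>

definition labelled :: "nat set \<Rightarrow> nat set \<Rightarrow> bool" where
  "labelled A E \<longleftrightarrow> (A = {1..} \<or> (\<exists>N\<ge>1. A = {1..N})) \<and> E = {1..card E}"

definition J_empty :: "real \<Rightarrow> nat \<Rightarrow> real set" where
  "J_empty \<epsilon> a = {(real a - 1) * \<epsilon> ..< real a * \<epsilon>}"

definition J :: "nat set \<Rightarrow> nat str set \<Rightarrow> (nat str \<Rightarrow> nat pmf) \<Rightarrow> real \<Rightarrow> nat \<Rightarrow> nat str \<Rightarrow> real set"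
  where
  "J A \<tau> p \<epsilon> a v = (let E = regular_symbols A \<tau> p \<epsilon> in
     if a \<in> E
     then {real (card E) * \<epsilon> + (\<Sum>i=1..<a. (pmf (p v) i - \<epsilon>)) ..<
           real (card E) * \<epsilon> + (\<Sum>i=1..a. (pmf (p v) i - \<epsilon>))}
     else {(\<Sum>i=1..<a. pmf (p v) i) ..< (\<Sum>i=1..a. pmf (p v) i)})"

definition K :: "nat set \<Rightarrow> nat str set \<Rightarrow> (nat str \<Rightarrow> nat pmf) \<Rightarrow> real \<Rightarrow> nat \<Rightarrow> nat str \<Rightarrow> real set"
  where
  "K A \<tau> p \<epsilon> a v =
     (if a \<in> regular_symbols A \<tau> p \<epsilon> then J_empty \<epsilon> a \<union> J A \<tau> p \<epsilon> a v else J A \<tau> p \<epsilon> a v)"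

text \<open>
  \<open>None\<close> is the value \<open>\<star>\<close>. For \<open>u\<close> outside \<open>[0,1[\<close> the value is irrelevant. The empty
  string serves as the value of \<^const>\<open>ctx\<close> for "no context", which is unambiguous when the
  tree is unbounded, since then it does not contain the empty string.
\<close>

definition F :: "nat set \<Rightarrow> nat str set \<Rightarrow> (nat str \<Rightarrow> nat pmf) \<Rightarrow> real \<Rightarrow>
    real \<Rightarrow> nat str \<Rightarrow> nat option" where
  "F A \<tau> p \<epsilon> u s =
     (if ctx \<tau> s \<noteq> Finite [] then Some (THE a. a \<in> A \<and> u \<in> K A \<tau> p \<epsilon> a (ctx \<tau> s))
      else if \<exists>a\<in>regular_symbols A \<tau> p \<epsilon>. u \<in> J_empty \<epsilon> a
        then Some (THE a. a \<in> regular_symbols A \<tau> p \<epsilon> \<and> u \<in> J_empty \<epsilon> a)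
      else None)"

section \<open>Coalescence times and the constructed chain\<close>

text \<open>
  Here \<open>u\<close> is a realisation of the two-sided uniform sequence, and the right end \<open>n\<close> of a window
  \<open>[m,n]\<close> is \<open>Fin i\<close> for an integer \<open>i\<close> or \<open>Pinf\<close>.
\<close>

definition L :: "nat set \<Rightarrow> nat str set \<Rightarrow> (nat str \<Rightarrow> nat pmf) \<Rightarrow> real \<Rightarrow>
    (int \<Rightarrow> real) \<Rightarrow> int \<Rightarrow> int extended \<Rightarrow> bool" where
  "L A \<tau> p \<epsilon> u m n \<longleftrightarrow> (\<exists>a :: int \<Rightarrow> nat. \<forall>i. m \<le> i \<and> Fin i \<le> n \<longrightarrow>
     a i \<in> A \<and> F A \<tau> p \<epsilon> (u i) (Finite (map a [m..i - 1])) = Some (a i))"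

definition theta :: "nat set \<Rightarrow> nat str set \<Rightarrow> (nat str \<Rightarrow> nat pmf) \<Rightarrow> real \<Rightarrow>
    (int \<Rightarrow> real) \<Rightarrow> int \<Rightarrow> int extended \<Rightarrow> int extended" where
  "theta A \<tau> p \<epsilon> u m n =
     (if \<exists>k\<le>m. L A \<tau> p \<epsilon> u k n then Fin (GREATEST k. k \<le> m \<and> L A \<tau> p \<epsilon> u k n) else Minf)"

text \<open>\<open>gen \<dots> u k j\<close> is the string generated recursively at the times \<open>k, \<dots>, k+j-1\<close>.\<close>

primrec gen :: "nat set \<Rightarrow> nat str set \<Rightarrow> (nat str \<Rightarrow> nat pmf) \<Rightarrow> real \<Rightarrow>
    (int \<Rightarrow> real) \<Rightarrow> int \<Rightarrow> nat \<Rightarrow> nat list" where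
  "gen A \<tau> p \<epsilon> u k 0 = []"
| "gen A \<tau> p \<epsilon> u k (Suc j) = gen A \<tau> p \<epsilon> u k j @
     [the (F A \<tau> p \<epsilon> (u (k + int j)) (Finite (gen A \<tau> p \<epsilon> u k j)))]"

text \<open>
  The symbol at time \<open>i\<close> is the common value computed for all the windows \<open>[m,n]\<close> that yield a
  symbol at time \<open>i\<close>.
\<close>

definition chain :: "nat set \<Rightarrow> nat str set \<Rightarrow> (nat str \<Rightarrow> nat pmf) \<Rightarrow> real \<Rightarrow>
    (int \<Rightarrow> real) \<Rightarrow> int \<Rightarrow> nat" where
  "chain A \<tau> p \<epsilon> u i = (THE a. \<exists>m n k. Fin m \<le> n \<and> theta A \<tau> p \<epsilon> u m n = Fin k \<and>
     k \<le> i \<and> Fin i \<le> n \<and> a = gen A \<tau> p \<epsilon> u k (nat (i - k) + 1) ! nat (i - k))"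

definition xi :: "nat set \<Rightarrow> nat str set \<Rightarrow> (nat str \<Rightarrow> nat pmf) \<Rightarrow> real \<Rightarrow>
    (int \<Rightarrow> real) \<Rightarrow> int \<Rightarrow> nat" where
  "xi A \<tau> p \<epsilon> u j = (if theta A \<tau> p \<epsilon> u j Pinf = Fin j then 1 else 0)"

section \<open>Renewal chains\<close>

definition enumerates :: "(int \<Rightarrow> int) \<Rightarrow> int set \<Rightarrow> bool" where
  "enumerates T S \<longleftrightarrow> (\<forall>i. T i < T (i + 1)) \<and> T 0 \<le> 0 \<and> 0 < T 1 \<and> S = range T"

text \<open>
  The normalised enumeration of the 1's of a 0-1 sequence; it exists, and is then unique, if and
  only if the 1's are unbounded in both directions.
\<close>

definition renewal_times :: "(int \<Rightarrow> nat) \<Rightarrow> int \<Rightarrow> int" where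
  "renewal_times x = (THE T. enumerates T {j. x j = 1})"

definition (in prob_space) ident_distr :: "'i set \<Rightarrow> 'c measure \<Rightarrow> ('i \<Rightarrow> 'a \<Rightarrow> 'c) \<Rightarrow> bool" where
  "ident_distr I N Y \<longleftrightarrow> (\<forall>i\<in>I. \<forall>j\<in>I. distr M N (Y i) = distr M N (Y j))"

text \<open>
  The enumeration in the definition of a renewal chain is required to exist almost surely.
\<close>

definition (in prob_space) renewal :: "(int \<Rightarrow> 'a \<Rightarrow> nat) \<Rightarrow> bool" where
  "renewal \<xi> \<longleftrightarrow>
     (\<forall>j. random_variable (count_space UNIV) (\<xi> j)) \<and>
     (\<forall>j. \<forall>\<omega>\<in>space M. \<xi> j \<omega> \<in> {0, 1}) \<and>
     (AE \<omega> in M. \<exists>T. enumerates T {j. \<xi> j \<omega> = 1}) \<and>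
     indep_vars (\<lambda>_. count_space UNIV)
       (\<lambda>i \<omega>. renewal_times (\<lambda>j. \<xi> j \<omega>) (i + 1) - renewal_times (\<lambda>j. \<xi> j \<omega>) i) UNIV \<and>
     ident_distr {i. i \<noteq> 0} (count_space UNIV)
       (\<lambda>i \<omega>. renewal_times (\<lambda>j. \<xi> j \<omega>) (i + 1) - renewal_times (\<lambda>j. \<xi> j \<omega>) i)"

end

theory Submission
  imports Defs "HOL-Real_Asymp.Real_Asymp"
begin

text \<open>
  Let \<open>\<xi>\<^sub>j = 1\<close> mean that generation from the empty past at time \<open>j\<close> never gets stuck; such a time is
  called a renewal below. Everything rests on two facts about renewals.

  The first is coalescence (\<open>produces_append\<close>): symbols generated from the empty past at \<open>n\<close> remain
  correct when an earlier past is added, since the update function is monotone in the past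
  (\<open>update_append\<close>). Hence, once \<open>n\<close> is known to be a renewal, whether \<open>m < n\<close> is a renewal and, if so,
  which symbols occur between \<open>m\<close> and \<open>n\<close> depends only on the noise at the times from \<open>m\<close> to \<open>n - 1\<close>. So if \<open>q s\<close> is the
  probability that generation from \<open>0\<close> yields \<open>s\<close> with no intermediate renewal, and \<open>\<rho>\<close> is the
  probability of a renewal at \<open>0\<close>, the strings between consecutive renewals \<open>T\<^sub>i\<close> satisfy
  \<open>P(S\<^bsub>-n\<^esub> = s\<^bsub>-n\<^esub>, \<dots>, S\<^sub>n = s\<^sub>n) = |s\<^sub>0| \<rho> \<Prod>\<^sub>i q s\<^sub>i\<close>
  (\<open>pr_cuts\<close>). The factor \<open>|s\<^sub>0|\<close> counts the positions of \<open>s\<^sub>0\<close> that cover the time \<open>0\<close>. A joint law with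
  product masses is independent with proportional marginals (\<open>indep_vars_factorised_masses\<close>): all the
  strings are independent, and those with \<open>i \<noteq> 0\<close> have the same law, proportional to \<open>q\<close>. Moreover
  the masses \<open>|s| \<rho> q s\<close> of \<open>S\<^sub>0\<close> are summable, and this says that the mean length of the other strings
  is finite. The increments of the renewal times are the lengths of the strings.

  The second is that \<open>\<rho> > 0\<close> (\<open>renewal_has_positive_probability\<close>). The noise spells the regular string
  \<open>w\<close> at given times with probability \<open>\<epsilon>\<^bsup>|w|\<^esup>\<close>, whatever the past is. By the growth condition on \<open>l\<close>, the
  generated string of length \<open>i\<close> has a context as soon as \<open>w\<close> occurs within the last
  \<open>ln i / (c C)\<close> symbols for some \<open>c < 1\<close>; this fails with probability of order \<open>i\<^bsup>-1/c\<^esup>\<close>, which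
  is summable. Starting with many copies of \<open>w\<close> one thus never gets stuck with positive probability.

  Positivity of \<open>\<rho>\<close> also implies that almost surely the renewals are unbounded in both directions
  (\<open>AE_recurs\<close>), by stationarity and independence alone.
\<close>

section \<open>Independence from factorising point masses\<close>

text \<open>
  The values \<open>y i\<close> are replaced by the sets \<open>B i\<close> one index at a time; each replacement sums a
  countable family of disjoint events, and the other factors do not depend on the summation variable.
\<close>

lemma (in prob_space) factorised_masses_rectangle:
  fixes Y :: "'i \<Rightarrow> 'a \<Rightarrow> 'b::countable" and g :: "'i \<Rightarrow> 'b \<Rightarrow> ennreal"
  assumes "finite H"
    and meas: "\<And>i. i \<in> H \<Longrightarrow> random_variable (count_space UNIV) (Y i)"
    and mass: "\<And>y. emeasure M {\<omega>\<in>space M. \<forall>i\<in>H. Y i \<omega> = y i} = (\<Prod>i\<in>H. g i (y i))"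
  shows "emeasure M {\<omega>\<in>space M. \<forall>i\<in>H. Y i \<omega> \<in> B i} =
    (\<Prod>i\<in>H. \<integral>\<^sup>+y. g i y \<partial>count_space (B i))"
proof -
  have "emeasure M {\<omega>\<in>space M. (\<forall>i\<in>J. Y i \<omega> \<in> B i) \<and> (\<forall>i\<in>H - J. Y i \<omega> = y i)} =
      (\<Prod>i\<in>J. \<integral>\<^sup>+y. g i y \<partial>count_space (B i)) * (\<Prod>i\<in>H - J. g i (y i))"
    if "finite J" "J \<subseteq> H" for J y
    using that
  proof (induction J arbitrary: y rule: finite_induct)
    case empty
    then show ?case by (simp add: mass)
  next
    case (insert j J)
    define E where "E = (\<lambda>b. {\<omega>\<in>space M. (\<forall>i\<in>J. Y i \<omega> \<in> B i) \<and> (\<forall>i\<in>H - J. Y i \<omega> = (y(j := b)) i)})"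
    have HJ: "H - J = insert j (H - insert j J)" using insert by auto
    have finHJ: "finite (H - insert j J)" using \<open>finite H\<close> by auto
    have "finite J" "finite (H - J)" using insert \<open>finite H\<close> by auto
    have [measurable]: "random_variable (count_space UNIV) (Y i)" if "i \<in> J \<union> (H - J)" for i
      using that insert by (auto intro: meas)
    have E_sets: "E b \<in> events" for b
      unfolding E_def using \<open>finite J\<close> \<open>finite (H - J)\<close> by measurable
    have "{\<omega>\<in>space M. (\<forall>i\<in>insert j J. Y i \<omega> \<in> B i) \<and> (\<forall>i\<in>H - insert j J. Y i \<omega> = y i)} = (\<Union>b\<in>B j. E b)"
      unfolding E_def HJ using insert.hyps by auto
    also have "emeasure M \<dots> = (\<integral>\<^sup>+b. emeasure M (E b) \<partial>count_space (B j))"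
    proof (rule emeasure_UN_countable)
      show "disjoint_family_on E (B j)"
        unfolding E_def HJ by (auto simp: disjoint_family_on_def)
    qed (use E_sets in auto)
    also have "\<dots> = (\<integral>\<^sup>+b. ((\<Prod>i\<in>J. \<integral>\<^sup>+y. g i y \<partial>count_space (B i)) * (\<Prod>i\<in>H - insert j J. g i (y i))) * g j b \<partial>count_space (B j))"
    proof (rule nn_integral_cong)
      fix b
      have "(\<Prod>i\<in>H - J. g i ((y(j := b)) i)) = g j b * (\<Prod>i\<in>H - insert j J. g i (y i))"
        unfolding HJ by (subst prod.insert[OF finHJ]) auto
      then show "emeasure M (E b) = ((\<Prod>i\<in>J. \<integral>\<^sup>+y. g i y \<partial>count_space (B i)) * (\<Prod>i\<in>H - insert j J. g i (y i))) * g j b"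
        unfolding E_def by (subst insert.IH) (use insert.prems in \<open>auto simp: mult_ac\<close>)
    qed
    also have "\<dots> = ((\<Prod>i\<in>J. \<integral>\<^sup>+y. g i y \<partial>count_space (B i)) * (\<Prod>i\<in>H - insert j J. g i (y i))) * (\<integral>\<^sup>+b. g j b \<partial>count_space (B j))"
      by (rule nn_integral_cmult) auto
    also have "\<dots> = (\<Prod>i\<in>insert j J. \<integral>\<^sup>+y. g i y \<partial>count_space (B i)) * (\<Prod>i\<in>H - insert j J. g i (y i))"
      using insert.hyps by (simp add: mult_ac)
    finally show ?case .
  qed
  from this[of H] \<open>finite H\<close> show ?thesis by simp
qed

text \<open>
  The factors \<open>g i\<close> are determined only up to constants with product \<open>1\<close>. Taking all the sets to be everything shows that
  the product of their totals is \<open>1\<close>, so that none of the totals is \<open>0\<close> or infinite; hence the totals of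
  the indices other than \<open>j\<close> multiply to the reciprocal of the total of \<open>g j\<close>.
\<close>

lemma (in prob_space) factorised_masses_marginal:
  fixes Y :: "'i \<Rightarrow> 'a \<Rightarrow> 'b::countable" and g :: "'i \<Rightarrow> 'b \<Rightarrow> ennreal"
  assumes fin: "finite H"
    and meas: "\<And>i. i \<in> H \<Longrightarrow> random_variable (count_space UNIV) (Y i)"
    and mass: "\<And>y. emeasure M {\<omega>\<in>space M. \<forall>i\<in>H. Y i \<omega> = y i} = (\<Prod>i\<in>H. g i (y i))"
    and "j \<in> H"
  shows "(\<integral>\<^sup>+y. g j y \<partial>count_space UNIV) \<noteq> 0" "(\<integral>\<^sup>+y. g j y \<partial>count_space UNIV) \<noteq> \<infinity>"
    and "emeasure M {\<omega>\<in>space M. Y j \<omega> \<in> B} =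
      (\<integral>\<^sup>+y. g j y \<partial>count_space B) / (\<integral>\<^sup>+y. g j y \<partial>count_space UNIV)"
proof -
  define m where "m i = (\<integral>\<^sup>+y. g i y \<partial>count_space UNIV)" for i
  define r where "r = (\<Prod>i\<in>H - {j}. m i)"
  have rect: "emeasure M {\<omega>\<in>space M. \<forall>i\<in>H. Y i \<omega> \<in> C i} =
      (\<Prod>i\<in>H. \<integral>\<^sup>+y. g i y \<partial>count_space (C i))" for C
    by (rule factorised_masses_rectangle[OF fin meas mass])
  have split: "(\<Prod>i\<in>H. h i) = h j * (\<Prod>i\<in>H - {j}. h i)" for h :: "'i \<Rightarrow> ennreal"
    using fin \<open>j \<in> H\<close> by (simp add: prod.remove)
  have one: "m j * r = 1"
    using rect[of "\<lambda>_. UNIV"] split[of m] by (simp add: emeasure_space_1 m_def r_def)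
  have "m j \<noteq> 0" using one by auto
  have "r \<noteq> 0" using one by auto
  have "m j \<noteq> \<infinity>" using one \<open>r \<noteq> 0\<close> by (auto simp: ennreal_top_mult split: if_splits)
  show "(\<integral>\<^sup>+y. g j y \<partial>count_space UNIV) \<noteq> 0" "(\<integral>\<^sup>+y. g j y \<partial>count_space UNIV) \<noteq> \<infinity>"
    using \<open>m j \<noteq> 0\<close> \<open>m j \<noteq> \<infinity>\<close> by (auto simp: m_def)
  have "emeasure M {\<omega>\<in>space M. Y j \<omega> \<in> B} = emeasure M {\<omega>\<in>space M. \<forall>i\<in>H. Y i \<omega> \<in> (if i = j then B else UNIV)}"
    using \<open>j \<in> H\<close> by (intro arg_cong[where f="emeasure M"]) (auto split: if_splits)
  also have "\<dots> = (\<integral>\<^sup>+y. g j y \<partial>count_space B) * r"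
    unfolding rect split r_def
    by (intro arg_cong2[where f="(*)"] prod.cong) (simp_all add: m_def split: if_splits)
  also have "r = 1 / m j"
    using one \<open>m j \<noteq> 0\<close> \<open>m j \<noteq> \<infinity>\<close>
    by (metis ennreal_times_divide infinity_ennreal_def mult.commute mult_divide_eq_ennreal)
  also have "(\<integral>\<^sup>+y. g j y \<partial>count_space B) * (1 / m j) = (\<integral>\<^sup>+y. g j y \<partial>count_space B) / m j"
    by (simp add: ennreal_times_divide)
  finally show "emeasure M {\<omega>\<in>space M. Y j \<omega> \<in> B} =
      (\<integral>\<^sup>+y. g j y \<partial>count_space B) / (\<integral>\<^sup>+y. g j y \<partial>count_space UNIV)"
    by (simp add: m_def)
qed

text \<open>
  The marginal probabilities differ from the sums of \<open>g i\<close> by the normalising constants, and these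
  constants cancel since their product over \<open>H\<close> is \<open>1\<close>. It is enough to know the joint masses for
  arbitrarily large finite \<open>H\<close>, because the remaining coordinates can be left unrestricted.
\<close>

lemma (in prob_space) indep_vars_factorised_masses:
  fixes Y :: "'i \<Rightarrow> 'a \<Rightarrow> 'b::countable" and g :: "'i \<Rightarrow> 'b \<Rightarrow> ennreal"
  assumes meas: "\<And>i. i \<in> I \<Longrightarrow> random_variable (count_space UNIV) (Y i)"
    and mass: "\<And>J. finite J \<Longrightarrow> J \<subseteq> I \<Longrightarrow> \<exists>H. finite H \<and> J \<subseteq> H \<and> H \<subseteq> I \<and>
      (\<forall>y. emeasure M {\<omega>\<in>space M. \<forall>i\<in>H. Y i \<omega> = y i} = (\<Prod>i\<in>H. g i (y i)))"
  shows "indep_vars (\<lambda>_. count_space UNIV) Y I"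
  unfolding indep_vars_def2
proof (intro conjI ballI meas indep_setsI)
  fix i assume "i \<in> I"
  then show "{Y i -` A \<inter> space M |A. A \<in> sets (count_space UNIV)} \<subseteq> events"
    using meas by (auto intro: measurable_sets)
next
  fix A J assume J: "J \<noteq> {}" "J \<subseteq> I" "finite J"
    and A: "\<forall>j\<in>J. A j \<in> {Y j -` A \<inter> space M |A. A \<in> sets (count_space UNIV)}"
  from A obtain B where B: "A j = Y j -` B j \<inter> space M" if "j \<in> J" for j
    by simp metis
  obtain H where H: "finite H" "J \<subseteq> H" "H \<subseteq> I"
    "\<And>y. emeasure M {\<omega>\<in>space M. \<forall>i\<in>H. Y i \<omega> = y i} = (\<Prod>i\<in>H. g i (y i))"
    using mass[OF J(3,2)] by auto
  have meas': "random_variable (count_space UNIV) (Y i)" if "i \<in> H" for i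
    using that H meas by auto
  note rect = factorised_masses_rectangle[OF H(1) meas' H(4)]
  note marg = factorised_masses_marginal[where Y=Y and g=g, OF H(1) meas' H(4)]
  define C where "C i = (if i \<in> J then B i else UNIV)" for i
  define m where "m i = (\<integral>\<^sup>+y. g i y \<partial>count_space UNIV)" for i
  have total: "(\<Prod>i\<in>H. m i) = 1"
    using rect[of "\<lambda>_. UNIV"] by (simp add: emeasure_space_1 m_def)
  have "emeasure M (\<Inter>j\<in>J. A j) = emeasure M {\<omega>\<in>space M. \<forall>i\<in>H. Y i \<omega> \<in> C i}"
    using J(1) H(2) by (intro arg_cong[where f="emeasure M"]) (auto simp: B C_def)
  also have "\<dots> = (\<Prod>i\<in>H. \<integral>\<^sup>+y. g i y \<partial>count_space (C i))"
    by (rule rect)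
  also have "\<dots> = (\<Prod>i\<in>H. emeasure M {\<omega>\<in>space M. Y i \<omega> \<in> C i} * m i)"
  proof (rule prod.cong)
    fix i assume "i \<in> H"
    from marg[of i, OF _ this] have "emeasure M {\<omega>\<in>space M. Y i \<omega> \<in> C i} = (\<integral>\<^sup>+y. g i y \<partial>count_space (C i)) / m i"
      and "m i \<noteq> 0" "m i \<noteq> \<infinity>"
      by (simp_all add: m_def)
    then show "(\<integral>\<^sup>+y. g i y \<partial>count_space (C i)) = emeasure M {\<omega>\<in>space M. Y i \<omega> \<in> C i} * m i"
      by (simp add: ennreal_divide_times ennreal_divide_self less_top)
  qed simp
  also have "\<dots> = (\<Prod>i\<in>H. emeasure M {\<omega>\<in>space M. Y i \<omega> \<in> C i})"
    by (simp add: prod.distrib total)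
  also have "\<dots> = (\<Prod>i\<in>J. emeasure M {\<omega>\<in>space M. Y i \<omega> \<in> C i})"
    using H(1,2) by (intro prod.mono_neutral_right) (auto simp: C_def emeasure_space_1)
  also have "\<dots> = (\<Prod>j\<in>J. emeasure M (A j))"
    by (intro prod.cong refl arg_cong[where f="emeasure M"]) (auto simp: B C_def)
  finally have "ennreal (prob (\<Inter>j\<in>J. A j)) = ennreal (\<Prod>j\<in>J. prob (A j))"
    by (simp add: emeasure_eq_measure prod_ennreal)
  then show "prob (\<Inter>j\<in>J. A j) = (\<Prod>j\<in>J. prob (A j))"
    by (subst (asm) ennreal_inj) (auto intro: prod_nonneg)
qed

lemma (in prob_space) indep_vars_cong_AE:
  assumes indep: "indep_vars N X I"
    and meas: "\<And>i. i \<in> I \<Longrightarrow> random_variable (N i) (Y i)"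
    and eq: "\<And>i. i \<in> I \<Longrightarrow> AE \<omega> in M. X i \<omega> = Y i \<omega>"
  shows "indep_vars N Y I"
  unfolding indep_vars_def2
proof (intro conjI ballI meas indep_setsI)
  fix i assume "i \<in> I"
  then show "{Y i -` A \<inter> space M |A. A \<in> sets (N i)} \<subseteq> events"
    using meas by (auto intro: measurable_sets)
next
  fix A J assume J: "J \<noteq> {}" "J \<subseteq> I" "finite J"
    and A: "\<forall>j\<in>J. A j \<in> {Y j -` A \<inter> space M |A. A \<in> sets (N j)}"
  from A obtain B where B: "A j = Y j -` B j \<inter> space M" "B j \<in> sets (N j)" if "j \<in> J" for j
    by simp metis
  have X: "random_variable (N i) (X i)" if "i \<in> I" for i
    using indep that by (auto simp: indep_vars_def2)
  have AE: "AE \<omega> in M. \<forall>j\<in>J. X j \<omega> = Y j \<omega>"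
    using J eq by (intro AE_finite_allI) auto
  have "prob (\<Inter>j\<in>J. A j) = prob (\<Inter>j\<in>J. X j -` B j \<inter> space M)"
  proof (rule measure_eq_AE)
    show "(\<Inter>j\<in>J. A j) \<in> events" "(\<Inter>j\<in>J. X j -` B j \<inter> space M) \<in> events"
      using J B(2) measurable_sets[OF meas] measurable_sets[OF X]
      by (auto simp: B(1) subset_eq simp del: INT_simps)
    show "AE x in M. x \<in> (\<Inter>j\<in>J. A j) \<longleftrightarrow> x \<in> (\<Inter>j\<in>J. X j -` B j \<inter> space M)"
      using AE by eventually_elim (auto simp: B)
  qed
  also have "\<dots> = (\<Prod>j\<in>J. prob (X j -` B j \<inter> space M))"
    using J B by (intro indep_varsD[OF indep]) auto
  also have "\<dots> = (\<Prod>j\<in>J. prob (A j))"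
  proof (rule prod.cong)
    fix j assume "j \<in> J"
    then have "j \<in> I" using J by auto
    show "prob (X j -` B j \<inter> space M) = prob (A j)"
    proof (rule measure_eq_AE)
      show "AE x in M. x \<in> X j -` B j \<inter> space M \<longleftrightarrow> x \<in> A j"
        using eq[OF \<open>j \<in> I\<close>] by eventually_elim (simp add: B \<open>j \<in> J\<close>)
    qed (use \<open>j \<in> J\<close> \<open>j \<in> I\<close> B X meas in \<open>auto intro!: measurable_sets\<close>)
  qed simp
  finally show "prob (\<Inter>j\<in>J. A j) = (\<Prod>j\<in>J. prob (A j))" .
qed

section \<open>Events of an i.i.d. sequence\<close>

abbreviation seqs :: "(int \<Rightarrow> real) measure" where
  "seqs \<equiv> PiM UNIV (\<lambda>_. borel)"

text \<open>
  This form is easier to check than measurability with respect to the coordinates in \<open>I\<close>. Together with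
  measurability with respect to all coordinates it has the same effect: compose with the map that
  extends a family indexed by \<open>I\<close> by a constant.
\<close>

definition depends_on :: "int set \<Rightarrow> ((int \<Rightarrow> real) \<Rightarrow> bool) \<Rightarrow> bool" where
  "depends_on I Q \<longleftrightarrow> (\<forall>u v. (\<forall>i\<in>I. u i = v i) \<longrightarrow> Q u = Q v)"

lemma depends_onD: "depends_on I Q \<Longrightarrow> (\<And>i. i \<in> I \<Longrightarrow> u i = v i) \<Longrightarrow> Q u = Q v"
  by (auto simp: depends_on_def)

lemma measurable_shift [measurable]: "(\<lambda>u n. u (n + k)) \<in> measurable seqs seqs"
  by (rule measurable_PiM_single') (auto simp: space_PiM)

locale iid_sequence = prob_space M for M :: "'b measure" +
  fixes U :: "int \<Rightarrow> 'b \<Rightarrow> real" and D :: "real measure"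
  assumes indep_U: "indep_vars (\<lambda>_. borel) U UNIV"
    and distr_U: "\<And>n. distr M borel (U n) = D"
begin

definition pr :: "((int \<Rightarrow> real) \<Rightarrow> bool) \<Rightarrow> real" where
  "pr Q = prob {\<omega>\<in>space M. Q (\<lambda>n. U n \<omega>)}"

lemma random_variable_U [measurable]: "random_variable borel (U n)"
  using indep_U unfolding indep_vars_def2 by blast

lemma random_variable_seq [measurable]: "random_variable seqs (\<lambda>\<omega> n. U n \<omega>)"
  by (rule measurable_PiM_single') (simp_all add: random_variable_U)

lemma pred_seq:
  "Measurable.pred seqs Q \<Longrightarrow> Measurable.pred M (\<lambda>\<omega>. Q (\<lambda>n. U n \<omega>))"
  using measurable_compose[OF random_variable_seq] .

lemma event_seq:
  "Measurable.pred seqs Q \<Longrightarrow> {\<omega>\<in>space M. Q (\<lambda>n. U n \<omega>)} \<in> events"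
  using pred_seq by (simp add: pred_def)

text \<open>
  The shifted sequence is again independent with the same marginals, so both have the product law.
\<close>

lemma pr_shift:
  assumes Q [measurable]: "Measurable.pred seqs Q"
  shows "pr (\<lambda>u. Q (\<lambda>n. u (n + k))) = pr Q"
proof -
  have law: "distr M seqs (\<lambda>\<omega> n. U (n + k) \<omega>) = PiM UNIV (\<lambda>_. D)" for k
  proof -
    have "indep_vars (\<lambda>_. borel) (\<lambda>n. U (n + k)) UNIV"
      unfolding indep_vars_def2
    proof (intro conjI ballI random_variable_U indep_setsI)
      fix A J assume J: "J \<noteq> {}" "J \<subseteq> (UNIV :: int set)" "finite J"
        and A: "\<forall>j\<in>J. A j \<in> {U (j + k) -` A \<inter> space M |A. A \<in> sets borel}"
      from A obtain B where B: "A j = U (j + k) -` B j \<inter> space M" "B j \<in> sets borel" if "j \<in> J" for j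
        by simp metis
      have "prob (\<Inter>i\<in>(\<lambda>j. j + k) ` J. U i -` B (i - k) \<inter> space M) =
          (\<Prod>i\<in>(\<lambda>j. j + k) ` J. prob (U i -` B (i - k) \<inter> space M))"
        using J B by (intro indep_varsD[OF indep_U]) auto
      moreover have "(\<Inter>i\<in>(\<lambda>j. j + k) ` J. U i -` B (i - k) \<inter> space M) = (\<Inter>j\<in>J. A j)"
        using J(1) B(1) by auto
      moreover have "(\<Prod>i\<in>(\<lambda>j. j + k) ` J. prob (U i -` B (i - k) \<inter> space M)) = (\<Prod>j\<in>J. prob (A j))"
        by (simp add: prod.reindex B(1))
      ultimately show "prob (\<Inter>j\<in>J. A j) = (\<Prod>j\<in>J. prob (A j))"
        by (simp only:)
    qed (auto intro: measurable_sets)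
    then show ?thesis
      by (subst (asm) indep_vars_iff_distr_eq_PiM) (auto simp: distr_U restrict_def)
  qed
  have "pr (\<lambda>u. Q (\<lambda>n. u (n + k))) = measure (distr M seqs (\<lambda>\<omega> n. U (n + k) \<omega>)) {u\<in>space seqs. Q u}" for k
  proof -
    have "(\<lambda>\<omega> n. U (n + k) \<omega>) \<in> measurable M seqs"
      using measurable_compose[OF random_variable_seq measurable_shift] .
    moreover have "{u\<in>space seqs. Q u} \<in> sets seqs"
      by measurable
    moreover have "(\<lambda>\<omega> n. U (n + k) \<omega>) -` {u\<in>space seqs. Q u} \<inter> space M = {\<omega>\<in>space M. Q (\<lambda>n. U (n + k) \<omega>)}"
      by (auto simp: space_PiM)
    ultimately show ?thesis unfolding pr_def by (simp add: measure_distr)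
  qed
  from this[of k] this[of 0] show ?thesis unfolding law by simp
qed

lemma pr_indep:
  assumes Q: "Measurable.pred seqs Q" "depends_on I Q"
    and R: "Measurable.pred seqs R" "depends_on I' R"
    and disj: "I \<inter> I' = {}"
  shows "pr (\<lambda>u. Q u \<and> R u) = pr Q * pr R"
proof -
  define ext where "ext A v = (\<lambda>i. if i \<in> A then v i else (0::real))" for A :: "int set" and v
  have ext: "ext A \<in> measurable (PiM A (\<lambda>_. borel)) seqs" for A
  proof (rule measurable_PiM_single')
    fix i show "(\<lambda>v. ext A v i) \<in> borel_measurable (PiM A (\<lambda>_. borel))"
      unfolding ext_def by (cases "i \<in> A") auto
  qed (auto simp: space_PiM)
  define E where "E A P = {v\<in>space (PiM A (\<lambda>_. borel)). P (ext A v)}" for A P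
  have E_sets: "E A P \<in> sets (PiM A (\<lambda>_. borel))" if "Measurable.pred seqs P" for A P
    using measurable_compose[OF ext that] unfolding E_def pred_def .
  have E_iff: "restrict (\<lambda>n. U n \<omega>) A \<in> E A P \<longleftrightarrow> P (\<lambda>n. U n \<omega>)" if "depends_on A P" for A P \<omega>
    unfolding E_def using depends_onD[OF that, of "\<lambda>n. U n \<omega>" "ext A (restrict (\<lambda>n. U n \<omega>) A)"]
    by (auto simp: ext_def space_PiM)
  have eq: "{x. P x} \<inter> space M = {x\<in>space M. P x}" for P
    by auto
  from indep_var_restrict[OF indep_U disj]
  have "indep_var (PiM I (\<lambda>_. borel)) (\<lambda>\<omega>. restrict (\<lambda>i. U i \<omega>) I) (PiM I' (\<lambda>_. borel)) (\<lambda>\<omega>. restrict (\<lambda>i. U i \<omega>) I')"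
    by simp
  from indep_varD[OF this E_sets[OF Q(1)] E_sets[OF R(1)]] show ?thesis
    unfolding pr_def vimage_def mem_Times_iff fst_conv snd_conv mem_Collect_eq E_iff[OF Q(2)] E_iff[OF R(2)]
    by (simp only: eq)
qed

lemma pr_ball_indep:
  assumes "finite A"
    and Q: "\<And>a. a \<in> A \<Longrightarrow> Measurable.pred seqs (Q a)" "\<And>a. a \<in> A \<Longrightarrow> depends_on (I a) (Q a)"
    and disj: "disjoint_family_on I A"
  shows "pr (\<lambda>u. \<forall>a\<in>A. Q a u) = (\<Prod>a\<in>A. pr (Q a))"
  using assms
proof (induction A rule: finite_induct)
  case empty
  then show ?case by (simp add: pr_def prob_space)
next
  case (insert a A)
  have "pr (\<lambda>u. \<forall>b\<in>insert a A. Q b u) = pr (\<lambda>u. Q a u \<and> (\<forall>b\<in>A. Q b u))"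
    by (simp add: pr_def)
  also have "\<dots> = pr (Q a) * pr (\<lambda>u. \<forall>b\<in>A. Q b u)"
  proof (rule pr_indep)
    show "Measurable.pred seqs (\<lambda>u. \<forall>b\<in>A. Q b u)"
      using insert by (intro pred_intros_finite) auto
    show "depends_on (\<Union>b\<in>A. I b) (\<lambda>u. \<forall>b\<in>A. Q b u)"
      using insert.prems(2) unfolding depends_on_def by (metis UN_I insert_iff)
    show "I a \<inter> (\<Union>b\<in>A. I b) = {}"
      using insert.prems(3) insert.hyps by (auto simp: disjoint_family_on_def)
  qed (use insert in auto)
  also have "pr (\<lambda>u. \<forall>b\<in>A. Q b u) = (\<Prod>b\<in>A. pr (Q b))"
    using insert by (intro insert.IH) (auto simp: disjoint_family_on_def)
  finally show ?case using insert.hyps by simp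
qed

lemma pr_mono:
  assumes "Measurable.pred seqs R" "\<And>u. Q u \<Longrightarrow> R u"
  shows "pr Q \<le> pr R"
  unfolding pr_def using assms by (intro finite_measure_mono event_seq) auto

lemma pr_not: "Measurable.pred seqs Q \<Longrightarrow> pr (\<lambda>u. \<not> Q u) = 1 - pr Q"
  unfolding pr_def by (intro prob_neg event_seq)

lemma pr_nonneg: "0 \<le> pr Q"
  by (simp add: pr_def)

lemma pr_disj_le:
  assumes "Measurable.pred seqs Q" "Measurable.pred seqs R"
  shows "pr (\<lambda>u. Q u \<or> R u) \<le> pr Q + pr R"
proof -
  have "{\<omega>\<in>space M. Q (\<lambda>n. U n \<omega>) \<or> R (\<lambda>n. U n \<omega>)} =
      {\<omega>\<in>space M. Q (\<lambda>n. U n \<omega>)} \<union> {\<omega>\<in>space M. R (\<lambda>n. U n \<omega>)}" by auto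
  then show ?thesis
    unfolding pr_def using measure_Un_le[OF event_seq[OF assms(1)] event_seq[OF assms(2)]] by simp
qed

lemma pr_diff:
  assumes "Measurable.pred seqs Q" "Measurable.pred seqs R" "\<And>u. R u \<Longrightarrow> Q u"
  shows "pr (\<lambda>u. Q u \<and> \<not> R u) = pr Q - pr R"
proof -
  have "{\<omega>\<in>space M. Q (\<lambda>n. U n \<omega>) \<and> \<not> R (\<lambda>n. U n \<omega>)} =
      {\<omega>\<in>space M. Q (\<lambda>n. U n \<omega>)} - {\<omega>\<in>space M. R (\<lambda>n. U n \<omega>)}" by auto
  moreover have "{\<omega>\<in>space M. R (\<lambda>n. U n \<omega>)} \<subseteq> {\<omega>\<in>space M. Q (\<lambda>n. U n \<omega>)}"
    using assms(3) by auto
  ultimately show ?thesis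
    unfolding pr_def
    using finite_measure_Diff[OF event_seq[OF assms(1)] event_seq[OF assms(2)]] by simp
qed

end

section \<open>Monotone update rules\<close>

text \<open>
  \<open>f x s\<close> is the symbol chosen by the noise \<open>x\<close> after the finite past \<open>s\<close>, and \<^const>\<open>None\<close> if more of the
  past has to be known. By monotonicity a symbol that has been determined is not changed by learning
  more of the past.
\<close>

locale monotone_update =
  fixes f :: "real \<Rightarrow> 'a::countable list \<Rightarrow> 'a option"
  assumes update_mono: "f x s = Some a \<Longrightarrow> f x (t @ s) = Some a"
    and update_measurable: "{x. f x s = Some a} \<in> sets borel"
begin

text \<open>
  Generation from the empty past: \<open>produces u m s\<close> says that the noise from time \<open>m\<close> on determines all
  the symbols of \<open>s\<close> at the times \<open>m, m + 1, \<dots>\<close> without any knowledge of the past before \<open>m\<close>. A renewal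
  is a time from which this never gets stuck.
\<close>

definition produces :: "(int \<Rightarrow> real) \<Rightarrow> int \<Rightarrow> 'a list \<Rightarrow> bool" where
  "produces u m s \<longleftrightarrow> (\<forall>i<length s. f (u (m + int i)) (take i s) = Some (s ! i))"

definition alive :: "(int \<Rightarrow> real) \<Rightarrow> int \<Rightarrow> nat \<Rightarrow> bool" where
  "alive u m j \<longleftrightarrow> (\<exists>s. length s = j \<and> produces u m s)"

definition renews :: "(int \<Rightarrow> real) \<Rightarrow> int \<Rightarrow> bool" where
  "renews u m \<longleftrightarrow> (\<forall>j. alive u m j)"

text \<open>
  The event that \<open>s\<close> is what lies between two consecutive renewals, the first of them at \<open>m\<close>, except
  that the second renewal is not demanded: the event is written in terms of the noise before it
  only. Lemma \<open>block_iff_renews\<close> below gives the relation.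
\<close>

definition block :: "(int \<Rightarrow> real) \<Rightarrow> int \<Rightarrow> 'a list \<Rightarrow> bool" where
  "block u m s \<longleftrightarrow> s \<noteq> [] \<and> produces u m s \<and>
     (\<forall>j. 0 < j \<and> j < length s \<longrightarrow> \<not> alive u (m + int j) (length s - j))"

definition symbol_at :: "(int \<Rightarrow> real) \<Rightarrow> int \<Rightarrow> 'a \<Rightarrow> bool" where
  "symbol_at u i a \<longleftrightarrow> (\<exists>k s. produces u k (s @ [a]) \<and> k + int (length s) = i)"

definition symbol :: "(int \<Rightarrow> real) \<Rightarrow> int \<Rightarrow> 'a" where
  "symbol u i = (THE a. symbol_at u i a)"

lemma produces_Nil [simp]: "produces u m []"
  by (simp add: produces_def)

lemma produces_snoc:
  "produces u m (s @ [a]) \<longleftrightarrow> produces u m s \<and> f (u (m + int (length s))) s = Some a"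
  unfolding produces_def
  by (auto simp: nth_append less_Suc_eq)

lemma produces_appendD: "produces u m (s @ t) \<Longrightarrow> produces u m s"
  unfolding produces_def
  by (metis (no_types, lifting) append_Nil2 diff_is_0_eq' length_append less_imp_le_nat nth_append take0
      take_append trans_less_add1)

lemma produces_take: "produces u m s \<Longrightarrow> produces u m (take n s)"
  using produces_appendD[of u m "take n s" "drop n s"] by simp

lemma produces_same_length:
  assumes "produces u m s" "produces u m t" "length s = length t"
  shows "s = t"
  using assms
proof (induction s arbitrary: t rule: rev_induct)
  case (snoc a s)
  then obtain t' b where t: "t = t' @ [b]"
    by (metis append_Nil2 length_0_conv rev_exhaust snoc_eq_iff_butlast)
  then have "s = t'" using snoc by (auto simp: produces_snoc)
  then show ?case using snoc.prems t by (simp add: produces_snoc)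
qed simp

lemma produces_prefix:
  assumes "produces u m s" "produces u m t" "length s \<le> length t"
  shows "s = take (length s) t"
  using assms produces_take[of u m t "length s"] by (intro produces_same_length) auto

text \<open>
  Coalescence. By monotonicity, a string generated from the empty past at a later time stays the same
  when the symbols generated before that time are put in front of it.
\<close>

lemma produces_append:
  assumes "produces u m s" "produces u (m + int (length s)) t"
  shows "produces u m (s @ t)"
  using assms(2)
proof (induction t rule: rev_induct)
  case (snoc a t)
  then have "produces u m (s @ t)" "f (u (m + int (length s) + int (length t))) t = Some a"
    by (auto simp: produces_snoc)
  then show ?case
    unfolding append_assoc[symmetric] produces_snoc by (auto simp: add.assoc intro: update_mono)
qed (use assms in simp)

lemma alive_le: "alive u m j \<Longrightarrow> i \<le> j \<Longrightarrow> alive u m i"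
  unfolding alive_def using produces_take[of u m _ i] by (metis length_take min.absorb2)

lemma alive_append: "alive u m i \<Longrightarrow> alive u (m + int i) j \<Longrightarrow> alive u m (i + j)"
  unfolding alive_def using produces_append by (metis length_append)

lemma renews_alive: "renews u m \<Longrightarrow> alive u m j"
  by (simp add: renews_def)

text \<open>
  The regeneration property. If there is a renewal at \<open>m + d\<close>, the noise after \<open>m + d\<close> has no influence
  on whether \<open>m\<close> is a renewal, so that past and future of a renewal become independent.
\<close>

lemma renews_iff_alive:
  assumes "renews u (m + int d)"
  shows "renews u m \<longleftrightarrow> alive u m d"
proof
  assume "alive u m d"
  show "renews u m" unfolding renews_def
  proof
    fix j show "alive u m j"
      using alive_append[OF \<open>alive u m d\<close> renews_alive[OF assms, of j]] by (rule alive_le) simp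
  qed
qed (rule renews_alive)

text \<open>
  By coalescence, starting times that yield a symbol at \<open>i\<close> yield the same one. As this holds for every
  noise sequence, \<open>symbol\<close> is measurable everywhere and not only up to a null set.
\<close>

lemma symbol_at_unique:
  assumes "symbol_at u i a" "symbol_at u i b"
  shows "a = b"
proof -
  have *: "a = b" if "produces u k (s @ [a])" "produces u k' (t @ [b])"
    "k + int (length s) = i" "k' + int (length t) = i" "k \<le> k'" for k k' s t a b
  proof -
    define d where "d = nat (k' - k)"
    have len: "d + length (t @ [b]) = length (s @ [a])" and k': "k' = k + int d" using that by (auto simp: d_def)
    define r where "r = take d (s @ [a])"
    have "length r = d" using len by (simp add: r_def)
    moreover have "produces u k r" unfolding r_def by (rule produces_take[OF that(1)])
    ultimately have "produces u k (r @ (t @ [b]))"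
      using that(2) k' by (metis produces_append)
    then have "s @ [a] = r @ (t @ [b])"
      using that(1) len \<open>length r = d\<close> by (intro produces_same_length) auto
    then show "a = b" by (metis append_assoc last_snoc)
  qed
  from assms show ?thesis unfolding symbol_at_def using * by (metis linear)
qed

lemma symbol_eq: "symbol_at u i a \<Longrightarrow> symbol u i = a"
  unfolding symbol_def using symbol_at_unique by blast

lemma symbol_produces:
  assumes "produces u k s" "i < length s"
  shows "symbol u (k + int i) = s ! i"
proof (rule symbol_eq)
  have "produces u k (take i s @ [s ! i])"
    using produces_take[OF assms(1), of "Suc i"] assms(2) by (simp add: take_Suc_conv_app_nth)
  then show "symbol_at u (k + int i) (s ! i)"
    unfolding symbol_at_def using assms(2) by (intro exI[of _ k] exI[of _ "take i s"]) auto
qed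

lemma block_iff_renews:
  assumes "renews u (k + int (length s))"
  shows "block u k s \<longleftrightarrow> s \<noteq> [] \<and> renews u k \<and> (\<forall>t. k < t \<and> t < k + int (length s) \<longrightarrow> \<not> renews u t) \<and>
    map (symbol u) [k..k + int (length s) - 1] = s"
proof -
  have inner: "renews u (k + int j) \<longleftrightarrow> alive u (k + int j) (length s - j)" if "j \<le> length s" for j
    using renews_iff_alive[of u "k + int j" "length s - j"] assms that by (simp add: algebra_simps of_nat_diff)
  have ball: "(\<forall>t. k < t \<and> t < k + int (length s) \<longrightarrow> \<not> renews u t) \<longleftrightarrow>
      (\<forall>j. 0 < j \<and> j < length s \<longrightarrow> \<not> renews u (k + int j))" (is "?l \<longleftrightarrow> ?r")
  proof
    assume ?r
    show ?l
    proof (intro allI impI)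
      fix t assume "k < t \<and> t < k + int (length s)"
      then have "0 < nat (t - k)" "nat (t - k) < length s" "k + int (nat (t - k)) = t" by auto
      with \<open>?r\<close> show "\<not> renews u t" by metis
    qed
  qed auto
  have str: "map (symbol u) [k..k + int (length s) - 1] = r" if "produces u k r" "length r = length s" for r
    using that by (intro nth_equalityI) (auto simp: symbol_produces)
  have "produces u k s \<longleftrightarrow> renews u k \<and> map (symbol u) [k..k + int (length s) - 1] = s"
    using inner[of 0] str unfolding alive_def by (auto; metis)
  then show ?thesis unfolding block_def ball using inner by auto
qed

subsection \<open>Dependence on the noise, shifts and measurability\<close>

lemma produces_shift: "produces (\<lambda>n. u (n + k)) m s \<longleftrightarrow> produces u (m + k) s"
  by (simp add: produces_def add_ac)

lemma alive_shift: "alive (\<lambda>n. u (n + k)) m j \<longleftrightarrow> alive u (m + k) j"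
  by (simp add: alive_def produces_shift)

lemma renews_shift: "renews (\<lambda>n. u (n + k)) m \<longleftrightarrow> renews u (m + k)"
  by (simp add: renews_def alive_shift)

lemma block_shift: "block (\<lambda>n. u (n + k)) m s \<longleftrightarrow> block u (m + k) s"
  by (simp add: block_def produces_shift alive_shift add_ac)

lemma produces_cong:
  "(\<And>i. m \<le> i \<Longrightarrow> i < m + int (length s) \<Longrightarrow> u i = v i) \<Longrightarrow> produces u m s = produces v m s"
  by (simp add: produces_def)

lemma alive_cong:
  "(\<And>i. m \<le> i \<Longrightarrow> i < m + int j \<Longrightarrow> u i = v i) \<Longrightarrow> alive u m j = alive v m j"
  unfolding alive_def using produces_cong[of m _ u v] by blast

lemma renews_cong: "(\<And>i. m \<le> i \<Longrightarrow> u i = v i) \<Longrightarrow> renews u m = renews v m"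
  unfolding renews_def using alive_cong[of m _ u v] by blast

lemma block_cong:
  assumes "\<And>i. m \<le> i \<Longrightarrow> i < m + int (length s) \<Longrightarrow> u i = v i"
  shows "block u m s = block v m s"
proof -
  have "alive u (m + int j) (length s - j) = alive v (m + int j) (length s - j)" if "j < length s" for j
    using that assms by (intro alive_cong) auto
  then show ?thesis unfolding block_def using produces_cong[of m s u v] assms by auto
qed

lemma pred_produces [measurable]: "Measurable.pred seqs (\<lambda>u. produces u m s)"
proof -
  have "Measurable.pred borel (\<lambda>x. f x t = Some a)" for t a
    using update_measurable[of t a] by (simp add: pred_def)
  then have [measurable]: "Measurable.pred seqs (\<lambda>u. f (u i) t = Some a)" for i t a
    by (rule measurable_compose[OF measurable_component_singleton[of i UNIV "\<lambda>_. borel"], rotated]) simp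
  show ?thesis unfolding produces_def by measurable
qed

lemma pred_alive [measurable]: "Measurable.pred seqs (\<lambda>u. alive u m j)"
  unfolding alive_def by measurable

lemma pred_renews [measurable]: "Measurable.pred seqs (\<lambda>u. renews u m)"
  unfolding renews_def by measurable

lemma pred_block [measurable]: "Measurable.pred seqs (\<lambda>u. block u m s)"
  unfolding block_def by measurable

lemma pred_symbol_at [measurable]: "Measurable.pred seqs (\<lambda>u. symbol_at u i a)"
  unfolding symbol_at_def by measurable

lemma measurable_symbol [measurable]: "(\<lambda>u. symbol u i) \<in> measurable seqs (count_space UNIV)"
  unfolding measurable_count_space_eq2_countable
proof (intro conjI ballI)
  fix a :: 'a
  have "symbol u i = a \<longleftrightarrow> symbol_at u i a \<or> ((\<forall>b. \<not> symbol_at u i b) \<and> a = (THE a. False))" for u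
  proof (cases "\<exists>b. symbol_at u i b")
    case True
    then show ?thesis using symbol_eq by metis
  next
    case False
    then show ?thesis by (auto simp: symbol_def)
  qed
  then have "(\<lambda>u. symbol u i) -` {a} \<inter> space seqs =
      {u\<in>space seqs. symbol_at u i a \<or> ((\<forall>b. \<not> symbol_at u i b) \<and> a = (THE a. False))}"
    by auto
  then show "(\<lambda>u. symbol u i) -` {a} \<inter> space seqs \<in> sets seqs" by simp
qed auto

end

section \<open>Enumerations of sets of integers\<close>

lemma enumerates_strict_mono:
  assumes "enumerates T S"
  shows "strict_mono T"
proof (rule strict_monoI)
  fix i j :: int assume "i < j"
  have "T i < T (i + 1 + int n)" for n
  proof (induction n)
    case (Suc n)
    have "T (i + 1 + int n) < T (i + 1 + int n + 1)" using assms unfolding enumerates_def by blast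
    with Suc show ?case by (simp add: algebra_simps)
  qed (use assms in \<open>auto simp: enumerates_def\<close>)
  from this[of "nat (j - i - 1)"] \<open>i < j\<close> show "T i < T j" by simp
qed

lemma enumerates_mem: "enumerates T S \<Longrightarrow> T i \<in> S"
  by (auto simp: enumerates_def)

lemma enumerates_gap:
  assumes T: "enumerates T S" and "T i < s" "s < T (i + 1)"
  shows "s \<notin> S"
proof
  assume "s \<in> S"
  then obtain j where "s = T j" using T by (auto simp: enumerates_def)
  then show False using assms strict_mono_less[OF enumerates_strict_mono[OF T]] by simp
qed

lemma enumerates_succ:
  assumes T: "enumerates T S" and b: "T i < b" "b \<in> S" "\<And>s. T i < s \<Longrightarrow> s < b \<Longrightarrow> s \<notin> S"
  shows "T (i + 1) = b"
proof -
  have "\<not> b < T (i + 1)" using enumerates_gap[OF T] b by blast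
  moreover have "\<not> T (i + 1) < b"
    using b(3)[of "T (i + 1)"] enumerates_mem[OF T] T by (auto simp: enumerates_def)
  ultimately show ?thesis by simp
qed

lemma enumerates_pred:
  assumes T: "enumerates T S" and a: "a < T (i + 1)" "a \<in> S" "\<And>s. a < s \<Longrightarrow> s < T (i + 1) \<Longrightarrow> s \<notin> S"
  shows "T i = a"
proof -
  have "\<not> T i < a" using enumerates_gap[OF T] a by blast
  moreover have "\<not> a < T i"
    using a(3)[of "T i"] enumerates_mem[OF T] T by (auto simp: enumerates_def)
  ultimately show ?thesis by simp
qed

lemma enumerates_zero:
  assumes T: "enumerates T S" and a: "a \<le> 0" "a \<in> S" "\<And>s. a < s \<Longrightarrow> s \<le> 0 \<Longrightarrow> s \<notin> S"
  shows "T 0 = a"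
proof -
  obtain j where j: "a = T j" using T a(2) by (auto simp: enumerates_def)
  have "j \<le> 0"
  proof (rule ccontr)
    assume "\<not> j \<le> 0"
    then have "T 1 \<le> T j" using strict_mono_less_eq[OF enumerates_strict_mono[OF T]] by simp
    then show False using T a(1) j by (auto simp: enumerates_def)
  qed
  then have "a \<le> T 0" using strict_mono_less_eq[OF enumerates_strict_mono[OF T]] j by simp
  moreover have "\<not> a < T 0" using a(3)[of "T 0"] enumerates_mem[OF T] T by (auto simp: enumerates_def)
  ultimately show ?thesis by simp
qed

lemma int_bidirectional_induct [case_names zero up down]:
  fixes P :: "int \<Rightarrow> bool"
  assumes "P 0" "\<And>i. 0 \<le> i \<Longrightarrow> P i \<Longrightarrow> P (i + 1)" "\<And>i. i < 0 \<Longrightarrow> P (i + 1) \<Longrightarrow> P i"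
  shows "P i"
proof (cases "0 \<le> i")
  case True
  then show ?thesis using assms by (induction rule: int_ge_induct) auto
next
  case False
  then have "i \<le> 0" by simp
  then show ?thesis using assms(1,3) by (induction rule: int_le_induct) auto
qed

lemma enumerates_unique:
  assumes T: "enumerates T S" and T': "enumerates T' S"
  shows "T = T'"
proof
  fix i show "T i = T' i"
  proof (induction i rule: int_bidirectional_induct)
    case zero
    show ?case
      using T' enumerates_mem[OF T'] enumerates_gap[OF T', of 0] by (intro enumerates_zero[OF T]) (auto simp: enumerates_def)
  next
    case (up i)
    then show ?case
      using T' enumerates_mem[OF T'] enumerates_gap[OF T', of i] by (intro enumerates_succ[OF T]) (auto simp: enumerates_def)
  next
    case (down i)
    then show ?case
      using T' enumerates_mem[OF T'] enumerates_gap[OF T', of i] by (intro enumerates_pred[OF T]) (auto simp: enumerates_def)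
  qed
qed

lemma ex_enumerates_iff:
  "(\<exists>T. enumerates T S) \<longleftrightarrow> (\<forall>k. \<exists>s\<in>S. k \<le> s) \<and> (\<forall>k. \<exists>s\<in>S. s \<le> k)"
proof
  assume "\<exists>T. enumerates T S"
  then obtain T where T: "enumerates T S" ..
  have step: "T i < T (i + 1)" for i using T by (auto simp: enumerates_def)
  have up: "k \<le> T (k - T 0)" if "T 0 \<le> k" for k
    using that
  proof (induction k rule: int_ge_induct)
    case (step i)
    then show ?case using \<open>\<And>i. T i < T (i + 1)\<close>[of "i - T 0"] by (simp add: algebra_simps)
  qed simp
  have down: "T (k - T 0) \<le> k" if "k \<le> T 0" for k
    using that
  proof (induction k rule: int_le_induct)
    case (step i)
    then show ?case using \<open>\<And>i. T i < T (i + 1)\<close>[of "i - 1 - T 0"] by (simp add: algebra_simps)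
  qed simp
  have "\<exists>s\<in>S. k \<le> s" "\<exists>s\<in>S. s \<le> k" for k
    using up[of k] down[of k] enumerates_mem[OF T] by (metis linear)+
  then show "(\<forall>k. \<exists>s\<in>S. k \<le> s) \<and> (\<forall>k. \<exists>s\<in>S. s \<le> k)" by blast
next
  assume unb: "(\<forall>k. \<exists>s\<in>S. k \<le> s) \<and> (\<forall>k. \<exists>s\<in>S. s \<le> k)"
  \<comment> \<open>The positive elements in increasing order become \<open>T 1, T 2, \<dots>\<close>, the other ones in decreasing order
    \<open>T 0, T (-1), \<dots>\<close>.\<close>
  define P where "P = {n. int n + 1 \<in> S}"
  define N where "N = {n. - int n \<in> S}"
  have "infinite P"
  proof -
    have "\<exists>n\<ge>m. n \<in> P" for m
    proof -
      obtain s where "s \<in> S" "int m + 1 \<le> s" using unb by blast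
      then show ?thesis by (intro exI[of _ "nat (s - 1)"]) (auto simp: P_def)
    qed
    then show ?thesis by (simp add: infinite_nat_iff_unbounded_le)
  qed
  have "infinite N"
  proof -
    have "\<exists>n\<ge>m. n \<in> N" for m
    proof -
      obtain s where "s \<in> S" "s \<le> - int m" using unb by blast
      then show ?thesis by (intro exI[of _ "nat (- s)"]) (auto simp: N_def)
    qed
    then show ?thesis by (simp add: infinite_nat_iff_unbounded_le)
  qed
  define T where "T i = (if 1 \<le> i then int (enumerate P (nat (i - 1))) + 1 else - int (enumerate N (nat (- i))))" for i
  have "T i < T (i + 1)" for i
  proof -
    consider "1 \<le> i" | "i = 0" | "i < 0" by linarith
    then show ?thesis
    proof cases
      case 1
      then have "nat (i + 1 - 1) = Suc (nat (i - 1))" by simp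
      then show ?thesis using 1 enumerate_step[OF \<open>infinite P\<close>, of "nat (i - 1)"] by (simp add: T_def)
    next
      case 3
      then have "nat (- i) = Suc (nat (- (i + 1)))" by simp
      then show ?thesis using 3 enumerate_step[OF \<open>infinite N\<close>, of "nat (- (i + 1))"] by (simp add: T_def)
    qed (simp add: T_def)
  qed
  moreover have "S = range T"
  proof (intro equalityI subsetI)
    fix s assume "s \<in> S"
    show "s \<in> range T"
    proof (cases "1 \<le> s")
      case True
      then have "nat (s - 1) \<in> P" using \<open>s \<in> S\<close> by (simp add: P_def)
      then obtain n where "enumerate P n = nat (s - 1)" using range_enumerate[OF \<open>infinite P\<close>] by (metis imageE)
      then have "T (int n + 1) = s" using True by (simp add: T_def)
      then show ?thesis by auto
    next
      case False
      then have "nat (- s) \<in> N" using \<open>s \<in> S\<close> by (simp add: N_def)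
      then obtain n where "enumerate N n = nat (- s)" using range_enumerate[OF \<open>infinite N\<close>] by (metis imageE)
      then have "T (- int n) = s" using False by (simp add: T_def)
      then show ?thesis by auto
    qed
  next
    fix s assume "s \<in> range T"
    then show "s \<in> S"
      using enumerate_in_set[OF \<open>infinite P\<close>] enumerate_in_set[OF \<open>infinite N\<close>]
      by (auto simp: T_def P_def N_def split: if_splits)
  qed
  ultimately show "\<exists>T. enumerates T S"
    by (intro exI[of _ T]) (auto simp: enumerates_def T_def)
qed

section \<open>Cutting the generated sequence at the renewals\<close>

text \<open>
  The start of the string number \<open>i\<close> when the strings \<open>s\<close> are put one after the other and the string
  number \<open>0\<close> starts at \<open>0\<close>.
\<close>

definition offset :: "(int \<Rightarrow> 'a list) \<Rightarrow> int \<Rightarrow> int" where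
  "offset s i = (if 0 \<le> i then \<Sum>j\<in>{0..<i}. int (length (s j)) else - (\<Sum>j\<in>{i..<0}. int (length (s j))))"

lemma offset_0 [simp]: "offset s 0 = 0"
  by (simp add: offset_def)

lemma offset_Suc: "offset s (i + 1) = offset s i + int (length (s i))"
proof -
  have "{0..<i + 1} = insert i {0..<i}" if "0 \<le> i" using that by auto
  moreover have "{i..<0} = insert i {i + 1..<0}" if "i < 0" using that by auto
  ultimately show ?thesis by (auto simp: offset_def)
qed

context monotone_update
begin

definition recurs :: "(int \<Rightarrow> real) \<Rightarrow> bool" where
  "recurs u \<longleftrightarrow> (\<exists>T. enumerates T {j. renews u j})"

definition renewal_time :: "(int \<Rightarrow> real) \<Rightarrow> int \<Rightarrow> int" where
  "renewal_time u = (THE T. enumerates T {j. renews u j})"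

definition cut :: "(int \<Rightarrow> real) \<Rightarrow> int \<Rightarrow> 'a list" where
  "cut u i = map (symbol u) [renewal_time u i..renewal_time u (i + 1) - 1]"

lemma renewal_time_enumerates: "recurs u \<Longrightarrow> enumerates (renewal_time u) {j. renews u j}"
  unfolding recurs_def renewal_time_def using enumerates_unique by (metis theI)

text \<open>
  Fixing the strings between renewals fixes the renewals up to a common shift. The normalisation
  \<open>T 0 \<le> 0 < T 1\<close> leaves one position of \<open>T 0\<close> for each of the symbols of the string that
  covers the time \<open>0\<close>; this is the source of the length bias of that string.
\<close>

lemma cuts_eq_iff:
  fixes n :: nat
  assumes "recurs u"
  shows "(\<forall>i\<in>{- int n..int n}. cut u i = s i) \<longleftrightarrow>
    (\<exists>t\<in>{- int (length (s 0))<..0}. (\<forall>i\<in>{- int n..int n}. block u (t + offset s i) (s i)) \<and>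
      renews u (t + offset s (int n + 1)))"
    (is "?L \<longleftrightarrow> ?R")
proof
  define T where "T = renewal_time u"
  have T: "enumerates T {j. renews u j}" using renewal_time_enumerates[OF assms] by (simp add: T_def)
  have T_less: "T i < T (i + 1)" for i using T by (simp add: enumerates_def)
  have ren: "renews u (T i)" for i using enumerates_mem[OF T] by simp
  assume ?L
  then have s: "map (symbol u) [T i..T (i + 1) - 1] = s i" if "i \<in> {- int n..int n}" for i
    using that by (simp add: cut_def T_def)
  have len: "T (i + 1) = T i + int (length (s i))" if "i \<in> {- int n..int n}" for i
    using s[OF that, symmetric] T_less[of i] by simp
  have off: "i \<in> {- int n..int n + 1} \<Longrightarrow> T i = T 0 + offset s i" for i
  proof (induction i rule: int_bidirectional_induct)
    case (up i)
    then show ?case using len[of i] by (simp add: offset_Suc)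
  next
    case (down i)
    then show ?case using len[of i] by (simp add: offset_Suc)
  qed simp
  show ?R
  proof (intro bexI[of _ "T 0"] conjI ballI)
    show "renews u (T 0 + offset s (int n + 1))"
      using ren[of "int n + 1"] off[of "int n + 1"] by simp
    fix i assume i: "i \<in> {- int n..int n}"
    have "block u (T i) (s i)"
    proof (subst block_iff_renews)
      show "renews u (T i + int (length (s i)))" using len[OF i] ren by metis
      have "s i \<noteq> []" using len[OF i] T_less[of i] by auto
      moreover have "map (symbol u) [T i..T i + int (length (s i)) - 1] = s i" using s[OF i] len[OF i] by simp
      ultimately show "s i \<noteq> [] \<and> renews u (T i) \<and> (\<forall>t. T i < t \<and> t < T i + int (length (s i)) \<longrightarrow> \<not> renews u t) \<and>
          map (symbol u) [T i..T i + int (length (s i)) - 1] = s i"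
        using ren[of i] enumerates_gap[OF T, of i] len[OF i] by auto
    qed
    then show "block u (T 0 + offset s i) (s i)" using off[of i] i by simp
  next
    show "T 0 \<in> {- int (length (s 0))<..0}" using T len[of 0] by (auto simp: enumerates_def)
  qed
next
  define T where "T = renewal_time u"
  have T: "enumerates T {j. renews u j}" using renewal_time_enumerates[OF assms] by (simp add: T_def)
  assume ?R
  then obtain t0 where t0: "- int (length (s 0)) < t0" "t0 \<le> 0"
    and blk: "\<And>i. i \<in> {- int n..int n} \<Longrightarrow> block u (t0 + offset s i) (s i)"
    and last: "renews u (t0 + offset s (int n + 1))"
    by auto
  define t where "t i = t0 + offset s i" for i
  have t_Suc: "t (i + 1) = t i + int (length (s i))" for i by (simp add: t_def offset_Suc)
  have prev: "renews u (t i) \<and> s i \<noteq> [] \<and> (\<forall>r. t i < r \<and> r < t (i + 1) \<longrightarrow> \<not> renews u r) \<and>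
      map (symbol u) [t i..t (i + 1) - 1] = s i"
    if "renews u (t (i + 1))" "i \<in> {- int n..int n}" for i
    using block_iff_renews[of u "t i" "s i"] that blk[of i] unfolding t_Suc by (auto simp: t_def)
  have ren: "renews u (t i)" if "i \<le> int n + 1" "- int n \<le> i" for i
    using that
  proof (induction i rule: int_le_induct)
    case base
    then show ?case using last by (simp add: t_def)
  next
    case (step i)
    then show ?case using prev[of "i - 1"] by auto
  qed
  have less: "t i < t (i + 1)" if "i \<in> {- int n..int n}" for i
    using prev[of i] ren[of "i + 1"] that unfolding t_Suc by auto
  have gap: "\<not> renews u r" if "i \<in> {- int n..int n}" "t i < r" "r < t (i + 1)" for i r
    using prev[of i] ren[of "i + 1"] that by auto
  have T_t: "i \<in> {- int n..int n + 1} \<Longrightarrow> T i = t i" for i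
  proof (induction i rule: int_bidirectional_induct)
    case zero
    have "t 1 > 0" using t_Suc[of 0] t0 by (simp add: t_def)
    then show ?case
      using t0 ren[of 0] gap[of 0] by (intro enumerates_zero[OF T]) (auto simp: t_def)
  next
    case (up i)
    then have "T i = t i" by simp
    with up.hyps up.prems show ?case using ren[of "i + 1"] gap[of i] less[of i] by (intro enumerates_succ[OF T]) auto
  next
    case (down i)
    then have "T (i + 1) = t (i + 1)" by simp
    with down.hyps down.prems show ?case using ren[of i] gap[of i] less[of i] by (intro enumerates_pred[OF T]) auto
  qed
  show ?L
  proof
    fix i assume i: "i \<in> {- int n..int n}"
    then have "cut u i = map (symbol u) [t i..t (i + 1) - 1]"
      using T_t[of i] T_t[of "i + 1"] by (simp add: cut_def T_def)
    also have "\<dots> = s i" using prev[of i] ren[of "i + 1"] i by auto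
    finally show "cut u i = s i" .
  qed
qed

lemma pred_recurs [measurable]: "Measurable.pred seqs recurs"
  unfolding recurs_def[abs_def] ex_enumerates_iff Bex_def mem_Collect_eq by measurable

text \<open>
  Each time is determined by its neighbour through conditions on the single integers, whence the
  induction away from the index \<open>0\<close>.
\<close>

lemma pred_renewal_time: "Measurable.pred seqs (\<lambda>u. recurs u \<and> renewal_time u i = t)"
proof (induction i arbitrary: t rule: int_bidirectional_induct)
  case zero
  have eq: "recurs u \<and> renewal_time u 0 = t \<longleftrightarrow> recurs u \<and> t \<le> 0 \<and> renews u t \<and> (\<forall>s. t < s \<and> s \<le> 0 \<longrightarrow> \<not> renews u s)" for u
  proof (cases "recurs u")
    case True
    note T = renewal_time_enumerates[OF True]
    show ?thesis
    proof
      assume "recurs u \<and> renewal_time u 0 = t"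
      then show "recurs u \<and> t \<le> 0 \<and> renews u t \<and> (\<forall>s. t < s \<and> s \<le> 0 \<longrightarrow> \<not> renews u s)"
        using T enumerates_mem[OF T, of 0] enumerates_gap[OF T, of 0] by (fastforce simp: enumerates_def)
    next
      assume "recurs u \<and> t \<le> 0 \<and> renews u t \<and> (\<forall>s. t < s \<and> s \<le> 0 \<longrightarrow> \<not> renews u s)"
      then show "recurs u \<and> renewal_time u 0 = t" using enumerates_zero[OF T, of t] by auto
    qed
  qed auto
  show ?case unfolding eq by measurable
next
  case (up i)
  note [measurable] = up.IH
  have eq: "recurs u \<and> renewal_time u (i + 1) = t \<longleftrightarrow>
      (\<exists>a. (recurs u \<and> renewal_time u i = a) \<and> a < t \<and> renews u t \<and> (\<forall>s. a < s \<and> s < t \<longrightarrow> \<not> renews u s))" for u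
  proof (cases "recurs u")
    case True
    note T = renewal_time_enumerates[OF True]
    have gap: "\<not> renews u r" if "renewal_time u i < r" "r < renewal_time u (i + 1)" for r
      using enumerates_gap[OF T that] by simp
    show ?thesis
      using T enumerates_mem[OF T, of "i + 1"] gap enumerates_succ[OF T, of i t] True
      by (auto simp: enumerates_def)
  qed auto
  show ?case unfolding eq by measurable
next
  case (down i)
  note [measurable] = down.IH
  have eq: "recurs u \<and> renewal_time u i = t \<longleftrightarrow>
      (\<exists>b. (recurs u \<and> renewal_time u (i + 1) = b) \<and> t < b \<and> renews u t \<and> (\<forall>s. t < s \<and> s < b \<longrightarrow> \<not> renews u s))" for u
  proof (cases "recurs u")
    case True
    note T = renewal_time_enumerates[OF True]
    have gap: "\<not> renews u r" if "renewal_time u i < r" "r < renewal_time u (i + 1)" for r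
      using enumerates_gap[OF T that] by simp
    show ?thesis
      using T enumerates_mem[OF T, of i] gap enumerates_pred[OF T, of t i] True
      by (auto simp: enumerates_def)
  qed auto
  show ?case unfolding eq by measurable
qed

lemma measurable_renewal_time [measurable]: "(\<lambda>u. renewal_time u i) \<in> measurable seqs (count_space UNIV)"
  unfolding measurable_count_space_eq2_countable
proof (intro conjI ballI)
  fix t :: int
  \<comment> \<open>Without recurrence the description is of the constantly false predicate, so that
    \<open>renewal_time u\<close> is one and the same function for all such \<open>u\<close>.\<close>
  have "renewal_time u i = t \<longleftrightarrow> (recurs u \<and> renewal_time u i = t) \<or> (\<not> recurs u \<and> t = (THE T. False) i)" for u
  proof (cases "recurs u")
    case False
    then have "(\<lambda>T. enumerates T {j. renews u j}) = (\<lambda>T. False)" by (auto simp: recurs_def)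
    then show ?thesis using False by (auto simp: renewal_time_def)
  qed auto
  then have "(\<lambda>u. renewal_time u i) -` {t} \<inter> space seqs =
      {u\<in>space seqs. (recurs u \<and> renewal_time u i = t) \<or> (\<not> recurs u \<and> t = (THE T. False) i)}"
    by blast
  also have "\<dots> \<in> sets seqs" using pred_renewal_time[of i t] by measurable
  finally show "(\<lambda>u. renewal_time u i) -` {t} \<inter> space seqs \<in> sets seqs" .
qed auto

lemma measurable_cut [measurable]: "(\<lambda>u. cut u i) \<in> measurable seqs (count_space UNIV)"
  unfolding measurable_count_space_eq2_countable
proof (intro conjI ballI)
  fix s :: "'a list"
  have "cut u i = s \<longleftrightarrow> length s = nat (renewal_time u (i + 1) - renewal_time u i) \<and>
      (\<forall>k<length s. \<exists>t. renewal_time u i = t \<and> symbol u (t + int k) = s ! k)" for u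
    unfolding cut_def list_eq_iff_nth_eq by auto
  then have "(\<lambda>u. cut u i) -` {s} \<inter> space seqs =
      {u\<in>space seqs. length s = nat (renewal_time u (i + 1) - renewal_time u i) \<and>
      (\<forall>k<length s. \<exists>t. renewal_time u i = t \<and> symbol u (t + int k) = s ! k)}"
    by blast
  also have "\<dots> \<in> sets seqs" by measurable
  finally show "(\<lambda>u. cut u i) -` {s} \<inter> space seqs \<in> sets seqs" .
qed auto

end

section \<open>The law of the strings between renewals\<close>

locale regenerative_sequence = iid_sequence M U D + monotone_update f
  for M :: "'b measure" and U D and f :: "real \<Rightarrow> 'a::countable list \<Rightarrow> 'a option" +
  assumes renews_positive: "pr (\<lambda>u. renews u 0) > 0"
begin

definition rho :: real where
  "rho = pr (\<lambda>u. renews u 0)"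

definition block_mass :: "'a list \<Rightarrow> real" where
  "block_mass s = pr (\<lambda>u. block u 0 s)"

lemma pr_renews: "pr (\<lambda>u. renews u t) = rho"
  using pr_shift[of "\<lambda>u. renews u 0" t] by (simp add: rho_def renews_shift)

lemma pr_block: "pr (\<lambda>u. block u t s) = block_mass s"
  using pr_shift[of "\<lambda>u. block u 0 s" t] by (simp add: block_mass_def block_shift)

text \<open>
  Consecutive blocks use disjoint parts of the noise, and the final renewal uses only later noise.
\<close>

lemma pr_blocks:
  assumes "\<And>i. t (i + 1) = t i + int (length (s i))"
  shows "pr (\<lambda>u. (\<forall>i\<in>{a..<a + int n}. block u (t i) (s i)) \<and> renews u (t (a + int n))) =
    (\<Prod>i\<in>{a..<a + int n}. block_mass (s i)) * rho"
proof (induction n arbitrary: a)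
  case 0
  then show ?case by (simp add: pr_renews)
next
  case (Suc n)
  have t_mono: "t i \<le> t (i + int k)" for i k
  proof (induction k)
    case (Suc k)
    have "t (i + int (Suc k)) = t (i + int k) + int (length (s (i + int k)))"
      using assms[of "i + int k"] by (simp add: add_ac)
    then show ?case using Suc by simp
  qed simp
  have ivl: "{a..<a + int (Suc n)} = insert a {a + 1..<a + 1 + int n}" by auto
  define R where "R u \<longleftrightarrow> (\<forall>i\<in>{a + 1..<a + 1 + int n}. block u (t i) (s i)) \<and> renews u (t (a + 1 + int n))" for u
  have "pr (\<lambda>u. (\<forall>i\<in>{a..<a + int (Suc n)}. block u (t i) (s i)) \<and> renews u (t (a + int (Suc n)))) =
      pr (\<lambda>u. block u (t a) (s a) \<and> R u)"
    unfolding ivl R_def by (simp add: conj_assoc add_ac)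
  also have "\<dots> = pr (\<lambda>u. block u (t a) (s a)) * pr R"
  proof (rule pr_indep)
    show "depends_on {t a..<t (a + 1)} (\<lambda>u. block u (t a) (s a))"
      unfolding depends_on_def assms[of a] by (intro allI impI block_cong) simp
    have "block u (t i) (s i) = block v (t i) (s i)"
      if "\<forall>r\<in>{t (a + 1)..}. u r = v r" "i \<in> {a + 1..<a + 1 + int n}" for u v i
      using that t_mono[of "a + 1" "nat (i - a - 1)"] by (intro block_cong) auto
    moreover have "renews u (t (a + 1 + int n)) = renews v (t (a + 1 + int n))"
      if "\<forall>r\<in>{t (a + 1)..}. u r = v r" for u v
      using that t_mono[of "a + 1" n] by (intro renews_cong) auto
    ultimately show "depends_on {t (a + 1)..} R"
      unfolding depends_on_def R_def by blast
    show "Measurable.pred seqs R" unfolding R_def[abs_def] by measurable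
    show "{t a..<t (a + 1)} \<inter> {t (a + 1)..} = {}" by auto
  qed simp_all
  also have "pr R = (\<Prod>i\<in>{a + 1..<a + 1 + int n}. block_mass (s i)) * rho"
    unfolding R_def[abs_def] by (rule Suc.IH)
  also have "pr (\<lambda>u. block u (t a) (s a)) * ((\<Prod>i\<in>{a + 1..<a + 1 + int n}. block_mass (s i)) * rho) =
      (\<Prod>i\<in>{a..<a + int (Suc n)}. block_mass (s i)) * rho"
    unfolding ivl by (simp add: pr_block)
  finally show ?case .
qed

text \<open>
  Let \<open>e\<close> be the probability that there is no renewal from time \<open>0\<close> on; by stationarity it is the same
  for every starting time. If there is no renewal from \<open>0\<close> on, then there is none from \<open>n\<close> on, and \<open>0\<close> is not
  a renewal. The latter is nearly the event that generation from \<open>0\<close> gets stuck before time \<open>n\<close>, which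
  is independent of the noise from \<open>n\<close> on. In the limit \<open>e \<le> e * (1 - rho)\<close>, and so \<open>e = 0\<close>.
\<close>

lemma no_renewal_after_null: "pr (\<lambda>u. \<forall>j\<ge>k. \<not> renews u j) = 0"
proof -
  define E where "E k u \<longleftrightarrow> (\<forall>j\<ge>k. \<not> renews u j)" for k u
  have E_meas [measurable]: "Measurable.pred seqs (E k)" for k unfolding E_def[abs_def] by measurable
  have E_shift: "E 0 (\<lambda>n. u (n + k)) \<longleftrightarrow> E k u" for k u
    unfolding E_def renews_shift by (metis add.commute add_le_cancel_left add_0_right diff_add_cancel)
  have e: "pr (E k) = pr (E 0)" for k
    using pr_shift[of "E 0" k] by (simp add: E_shift)
  define al where "al n = pr (\<lambda>u. alive u 0 n)" for n
  have "pr (E 0) \<le> pr (E 0) * (1 - al n) + (al n - rho)" for n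
  proof -
    have "pr (E 0) \<le> pr (\<lambda>u. (\<not> alive u 0 n \<and> E (int n) u) \<or> (alive u 0 n \<and> \<not> renews u 0))"
      by (intro pr_mono) (auto simp: E_def)
    also have "\<dots> \<le> pr (\<lambda>u. \<not> alive u 0 n \<and> E (int n) u) + pr (\<lambda>u. alive u 0 n \<and> \<not> renews u 0)"
      by (rule pr_disj_le) measurable
    also have "pr (\<lambda>u. \<not> alive u 0 n \<and> E (int n) u) = pr (\<lambda>u. \<not> alive u 0 n) * pr (E (int n))"
    proof (rule pr_indep)
      show "depends_on {0..<int n} (\<lambda>u. \<not> alive u 0 n)"
        unfolding depends_on_def by (intro allI impI arg_cong[where f=Not] alive_cong) simp
      show "depends_on {int n..} (E (int n))"
        unfolding depends_on_def E_def using renews_cong by (metis atLeast_iff order_trans)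
      show "Measurable.pred seqs (\<lambda>u. \<not> alive u 0 n)" by measurable
      show "{0..<int n} \<inter> {int n..} = {}" by auto
    qed (simp_all add: E_meas)
    also have "pr (\<lambda>u. \<not> alive u 0 n) = 1 - al n"
      unfolding al_def by (rule pr_not) measurable
    also have "pr (\<lambda>u. alive u 0 n \<and> \<not> renews u 0) = al n - rho"
      unfolding al_def rho_def by (rule pr_diff[OF pred_alive pred_renews renews_alive])
    finally show ?thesis by (simp add: e[of "int n"] mult.commute)
  qed
  moreover have "al \<longlonglongrightarrow> rho"
  proof -
    have "(\<lambda>n. prob {\<omega>\<in>space M. alive (\<lambda>i. U i \<omega>) 0 n}) \<longlonglongrightarrow> prob (\<Inter>n. {\<omega>\<in>space M. alive (\<lambda>i. U i \<omega>) 0 n})"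
      by (intro finite_Lim_measure_decseq) (auto intro!: event_seq decseq_SucI intro: alive_le)
    also have "(\<Inter>n. {\<omega>\<in>space M. alive (\<lambda>i. U i \<omega>) 0 n}) = {\<omega>\<in>space M. renews (\<lambda>i. U i \<omega>) 0}"
      by (auto simp: renews_def)
    finally show ?thesis by (simp add: al_def[abs_def] pr_def rho_def)
  qed
  then have "(\<lambda>n. pr (E 0) * (1 - al n) + (al n - rho)) \<longlonglongrightarrow> pr (E 0) * (1 - rho) + (rho - rho)"
    by (intro tendsto_intros)
  ultimately have "pr (E 0) \<le> pr (E 0) * (1 - rho)"
    by (intro LIMSEQ_le_const) auto
  then have "pr (E 0) * rho \<le> 0" by (simp add: algebra_simps)
  moreover have "rho > 0" using renews_positive by (simp add: rho_def)
  ultimately have "pr (E 0) = 0" using pr_nonneg[of "E 0"] by (simp add: mult_le_0_iff)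
  then show ?thesis using e[of k] by (simp add: E_def[abs_def])
qed

text \<open>
  By stationarity a window far in the past is as likely to contain no renewal as a window of the same
  length starting at \<open>0\<close>.
\<close>

lemma no_renewal_before_null: "pr (\<lambda>u. \<forall>j\<le>k. \<not> renews u j) = 0"
proof -
  have "pr (\<lambda>u. \<forall>j\<le>k. \<not> renews u j) \<le> pr (\<lambda>u. \<forall>j\<in>{0..int N}. \<not> renews u j)" for N
  proof -
    have "pr (\<lambda>u. \<forall>j\<le>k. \<not> renews u j) \<le> pr (\<lambda>u. \<forall>j\<in>{0..int N}. \<not> renews (\<lambda>n. u (n + (k - int N))) j)"
      by (intro pr_mono) (auto simp: renews_shift)
    also have "\<dots> = pr (\<lambda>u. \<forall>j\<in>{0..int N}. \<not> renews u j)"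
      by (rule pr_shift) measurable
    finally show ?thesis .
  qed
  moreover have "(\<lambda>N. pr (\<lambda>u. \<forall>j\<in>{0..int N}. \<not> renews u j)) \<longlonglongrightarrow> 0"
  proof -
    have all_iff: "(\<forall>N. \<forall>j\<in>{0..int N}. P j) \<longleftrightarrow> (\<forall>j\<ge>0. P j)" for P
      by (metis atLeastAtMost_iff nat_0_le order_refl)
    have "(\<lambda>N. prob {\<omega>\<in>space M. \<forall>j\<in>{0..int N}. \<not> renews (\<lambda>i. U i \<omega>) j})
        \<longlonglongrightarrow> prob (\<Inter>N. {\<omega>\<in>space M. \<forall>j\<in>{0..int N}. \<not> renews (\<lambda>i. U i \<omega>) j})"
      by (intro finite_Lim_measure_decseq) (auto intro!: event_seq decseq_SucI)
    also have "(\<Inter>N. {\<omega>\<in>space M. \<forall>j\<in>{0..int N}. \<not> renews (\<lambda>i. U i \<omega>) j}) =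
        {\<omega>\<in>space M. \<forall>N. \<forall>j\<in>{0..int N}. \<not> renews (\<lambda>i. U i \<omega>) j}"
      by blast
    also have "\<dots> = {\<omega>\<in>space M. \<forall>j\<ge>0. \<not> renews (\<lambda>i. U i \<omega>) j}"
      unfolding all_iff ..
    finally show ?thesis using no_renewal_after_null[of 0] by (simp add: pr_def)
  qed
  ultimately have "pr (\<lambda>u. \<forall>j\<le>k. \<not> renews u j) \<le> 0"
    by (intro LIMSEQ_le_const) auto
  then show ?thesis using pr_nonneg by (simp add: order_antisym)
qed

lemma AE_recurs: "AE \<omega> in M. recurs (\<lambda>n. U n \<omega>)"
proof -
  have "AE \<omega> in M. \<not> (\<forall>j\<ge>k. \<not> renews (\<lambda>n. U n \<omega>) j)" for k
    using no_renewal_after_null[of k] unfolding pr_def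
    by (subst (asm) prob_Collect_eq_0) (auto intro!: event_seq)
  moreover have "AE \<omega> in M. \<not> (\<forall>j\<le>k. \<not> renews (\<lambda>n. U n \<omega>) j)" for k
    using no_renewal_before_null[of k] unfolding pr_def
    by (subst (asm) prob_Collect_eq_0) (auto intro!: event_seq)
  ultimately have "AE \<omega> in M. \<forall>k. \<not> (\<forall>j\<ge>k. \<not> renews (\<lambda>n. U n \<omega>) j) \<and> \<not> (\<forall>j\<le>k. \<not> renews (\<lambda>n. U n \<omega>) j)"
    by (simp add: AE_all_countable)
  then show ?thesis
    by eventually_elim (auto simp: recurs_def ex_enumerates_iff)
qed

text \<open>
  The sum over the position of the string that covers the time \<open>0\<close> consists of equal terms, one for
  each of its symbols.
\<close>

lemma pr_cuts:
  fixes n :: nat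
  shows "pr (\<lambda>u. \<forall>i\<in>{- int n..int n}. cut u i = s i) =
    real (length (s 0)) * rho * (\<Prod>i\<in>{- int n..int n}. block_mass (s i))"
proof -
  define Q where "Q t u \<longleftrightarrow> (\<forall>i\<in>{- int n..int n}. block u (t + offset s i) (s i)) \<and>
      renews u (t + offset s (int n + 1))" for t u
  have Q_meas [measurable]: "Measurable.pred seqs (Q t)" for t unfolding Q_def[abs_def] by measurable
  have "pr (\<lambda>u. \<forall>i\<in>{- int n..int n}. cut u i = s i) =
      prob (\<Union>t\<in>{- int (length (s 0))<..0}. {\<omega>\<in>space M. Q t (\<lambda>n. U n \<omega>)})"
    unfolding pr_def
  proof (rule measure_eq_AE)
    show "AE \<omega> in M. (\<omega> \<in> {\<omega>\<in>space M. \<forall>i\<in>{- int n..int n}. cut (\<lambda>n. U n \<omega>) i = s i}) =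
        (\<omega> \<in> (\<Union>t\<in>{- int (length (s 0))<..0}. {\<omega>\<in>space M. Q t (\<lambda>n. U n \<omega>)}))"
      using AE_recurs by eventually_elim (auto simp: cuts_eq_iff Q_def)
  qed (auto intro!: event_seq)
  also have "\<dots> = (\<Sum>t\<in>{- int (length (s 0))<..0}. prob {\<omega>\<in>space M. Q t (\<lambda>n. U n \<omega>)})"
  proof (rule finite_measure_finite_Union)
    have first: "renews u t \<and> (\<forall>r. t < r \<and> r < t + int (length (s 0)) \<longrightarrow> \<not> renews u r)" if "Q t u" for t u
    proof -
      define t' where "t' i = t + offset s i" for i
      have t'_Suc: "t' (i + 1) = t' i + int (length (s i))" for i by (simp add: t'_def offset_Suc)
      have "renews u (t' i)" if "i \<le> int n + 1" "0 \<le> i" for i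
        using that
      proof (induction i rule: int_le_induct)
        case base
        then show ?case using \<open>Q t u\<close> by (simp add: t'_def Q_def)
      next
        case (step i)
        then have "renews u (t' (i - 1) + int (length (s (i - 1))))"
          using t'_Suc[of "i - 1"] by simp
        moreover have "block u (t' (i - 1)) (s (i - 1))"
          using step \<open>Q t u\<close> by (simp add: Q_def t'_def)
        ultimately show ?case using block_iff_renews by blast
      qed
      from this[of 1] have "renews u (t + int (length (s 0)))"
        using t'_Suc[of 0] by (simp add: t'_def)
      moreover have "block u t (s 0)"
        using \<open>Q t u\<close> unfolding Q_def by (metis add.right_neutral atLeastAtMost_iff neg_le_0_iff_le offset_0 of_nat_0_le_iff)
      ultimately show ?thesis using block_iff_renews by blast
    qed
    have "\<not> (Q t u \<and> Q t' u)" if "t < t'" "t' \<le> 0" "- int (length (s 0)) < t" for t t' u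
      using first[of t u] first[of t' u] that by auto
    then show "disjoint_family_on (\<lambda>t. {\<omega>\<in>space M. Q t (\<lambda>n. U n \<omega>)}) {- int (length (s 0))<..0}"
      unfolding disjoint_family_on_def by (auto; metis linorder_neqE)
  qed (auto intro!: event_seq)
  also have "\<dots> = (\<Sum>t\<in>{- int (length (s 0))<..0}. (\<Prod>i\<in>{- int n..int n}. block_mass (s i)) * rho)"
  proof (rule sum.cong)
    fix t
    have "{- int n..<- int n + int (2 * n + 1)} = {- int n..int n}" by auto
    then show "prob {\<omega>\<in>space M. Q t (\<lambda>n. U n \<omega>)} = (\<Prod>i\<in>{- int n..int n}. block_mass (s i)) * rho"
      using pr_blocks[of "\<lambda>i. t + offset s i" s "- int n" "2 * n + 1"]
      by (simp add: offset_Suc add.assoc pr_def Q_def add.commute)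
  qed simp
  also have "\<dots> = real (length (s 0)) * rho * (\<Prod>i\<in>{- int n..int n}. block_mass (s i))"
    by simp
  finally show ?thesis .
qed

definition cut_mass :: "int \<Rightarrow> 'a list \<Rightarrow> ennreal" where
  "cut_mass i s = (if i = 0 then ennreal (real (length s) * rho * block_mass s) else ennreal (block_mass s))"

abbreviation Cut :: "int \<Rightarrow> 'b \<Rightarrow> 'a list" where
  "Cut i \<omega> \<equiv> cut (\<lambda>n. U n \<omega>) i"

lemma random_variable_Cut [measurable]: "random_variable (count_space UNIV) (Cut i)"
  using measurable_compose[OF random_variable_seq measurable_cut] .

lemma cuts_factorise:
  "emeasure M {\<omega>\<in>space M. \<forall>i\<in>{- int n..int n}. Cut i \<omega> = s i} = (\<Prod>i\<in>{- int n..int n}. cut_mass i (s i))"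
proof -
  have bm: "0 \<le> block_mass t" for t by (simp add: block_mass_def pr_nonneg)
  have rho: "0 \<le> rho" by (simp add: rho_def pr_nonneg)
  have "(\<Prod>i\<in>{- int n..int n}. cut_mass i (s i)) = cut_mass 0 (s 0) * (\<Prod>i\<in>{- int n..int n} - {0}. cut_mass i (s i))"
    by (rule prod.remove) auto
  also have "(\<Prod>i\<in>{- int n..int n} - {0}. cut_mass i (s i)) = ennreal (\<Prod>i\<in>{- int n..int n} - {0}. block_mass (s i))"
    by (subst prod_ennreal[symmetric]) (auto simp: cut_mass_def bm intro!: prod.cong)
  also have "cut_mass 0 (s 0) * \<dots> = ennreal (real (length (s 0)) * rho * (block_mass (s 0) * (\<Prod>i\<in>{- int n..int n} - {0}. block_mass (s i))))"
    by (simp add: cut_mass_def ennreal_mult'' [symmetric] bm rho prod_nonneg mult.assoc)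
  also have "block_mass (s 0) * (\<Prod>i\<in>{- int n..int n} - {0}. block_mass (s i)) = (\<Prod>i\<in>{- int n..int n}. block_mass (s i))"
    by (rule prod.remove[symmetric]) auto
  also have "real (length (s 0)) * rho * \<dots> = pr (\<lambda>u. \<forall>i\<in>{- int n..int n}. cut u i = s i)"
    by (rule pr_cuts[symmetric])
  finally show ?thesis by (simp add: pr_def emeasure_eq_measure)
qed

theorem indep_Cut: "indep_vars (\<lambda>_. count_space UNIV) Cut UNIV"
proof (rule indep_vars_factorised_masses[where g = cut_mass])
  fix J :: "int set" assume "finite J"
  obtain n where "J \<subseteq> {- int n..int n}"
  proof (rule that)
    show "J \<subseteq> {- int (nat (\<Sum>j\<in>J. \<bar>j\<bar>))..int (nat (\<Sum>j\<in>J. \<bar>j\<bar>))}"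
      using member_le_sum[OF _ _ \<open>finite J\<close>, of _ abs] by (fastforce simp: abs_le_iff)
  qed
  then show "\<exists>H. finite H \<and> J \<subseteq> H \<and> H \<subseteq> UNIV \<and>
      (\<forall>y. emeasure M {\<omega>\<in>space M. \<forall>i\<in>H. Cut i \<omega> = y i} = (\<Prod>i\<in>H. cut_mass i (y i)))"
    using cuts_factorise[of n] by (intro exI[of _ "{- int n..int n}"]) auto
qed simp

lemma Cut_marginal:
  shows "(\<integral>\<^sup>+s. cut_mass i s \<partial>count_space UNIV) \<noteq> 0" "(\<integral>\<^sup>+s. cut_mass i s \<partial>count_space UNIV) \<noteq> \<infinity>"
    and "emeasure M {\<omega>\<in>space M. Cut i \<omega> \<in> B} =
      (\<integral>\<^sup>+s. cut_mass i s \<partial>count_space B) / (\<integral>\<^sup>+s. cut_mass i s \<partial>count_space UNIV)"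
proof -
  have "i \<in> {- int (nat \<bar>i\<bar>)..int (nat \<bar>i\<bar>)}" by auto
  note * = factorised_masses_marginal[where Y = Cut and g = cut_mass, OF _ _ cuts_factorise this]
  show "(\<integral>\<^sup>+s. cut_mass i s \<partial>count_space UNIV) \<noteq> 0" "(\<integral>\<^sup>+s. cut_mass i s \<partial>count_space UNIV) \<noteq> \<infinity>"
    "emeasure M {\<omega>\<in>space M. Cut i \<omega> \<in> B} =
      (\<integral>\<^sup>+s. cut_mass i s \<partial>count_space B) / (\<integral>\<^sup>+s. cut_mass i s \<partial>count_space UNIV)"
    by (rule *; simp)+
qed

theorem ident_distr_Cut: "ident_distr {i. i \<noteq> 0} (count_space UNIV) Cut"
  unfolding ident_distr_def
proof (intro ballI measure_eqI)
  fix i j :: int and A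
  assume ij: "i \<in> {i. i \<noteq> 0}" "j \<in> {i. i \<noteq> 0}"
  have "cut_mass i = cut_mass j" using ij by (auto simp: cut_mass_def)
  then show "emeasure (distr M (count_space UNIV) (Cut i)) A = emeasure (distr M (count_space UNIV) (Cut j)) A"
    using Cut_marginal(3)[of i A] Cut_marginal(3)[of j A]
    by (simp add: emeasure_distr vimage_def Int_def conj_commute)
qed simp

text \<open>
  The masses of the string number \<open>0\<close> are those of the others weighted by the length and multiplied by
  \<open>rho\<close>. Being the masses of a probability law up to a factor, they have a finite sum, and this sum is
  the mean length of the other strings up to a factor.
\<close>

theorem integrable_length_Cut:
  assumes "i \<noteq> 0"
  shows "integrable M (\<lambda>\<omega>. real (length (Cut i \<omega>)))"
proof (rule integrableI_bounded)
  define m where "m = (\<integral>\<^sup>+s. cut_mass i s \<partial>count_space UNIV)"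
  have rho: "0 < rho" using renews_positive by (simp add: rho_def)
  obtain r where r: "m = ennreal r" "0 < r"
    using Cut_marginal(1,2)[of i] by (cases m) (auto simp: m_def top_unique order_le_less)
  have mass: "cut_mass i = (\<lambda>s. ennreal (block_mass s))"
    using assms by (auto simp: cut_mass_def)
  have law: "distr M (count_space UNIV) (Cut i) = density (count_space UNIV) (\<lambda>s. block_mass s / m)"
  proof (rule measure_eqI_countable[of _ UNIV])
    fix s :: "'a list"
    have "emeasure (distr M (count_space UNIV) (Cut i)) {s} = emeasure M {\<omega>\<in>space M. Cut i \<omega> \<in> {s}}"
      by (simp add: emeasure_distr vimage_def Int_def conj_commute)
    also have "\<dots> = block_mass s / m"
      unfolding Cut_marginal(3) by (simp add: mass m_def nn_integral_count_space_finite)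
    finally show "emeasure (distr M (count_space UNIV) (Cut i)) {s} =
        emeasure (density (count_space UNIV) (\<lambda>s. block_mass s / m)) {s}"
      by (simp add: emeasure_density nn_integral_count_space_indicator[symmetric] nn_integral_count_space_finite)
  qed auto
  have "(\<integral>\<^sup>+\<omega>. ennreal (norm (real (length (Cut i \<omega>)))) \<partial>M) =
      (\<integral>\<^sup>+s. ennreal (real (length s)) \<partial>distr M (count_space UNIV) (Cut i))"
    by (subst nn_integral_distr) auto
  also have "\<dots> = (\<integral>\<^sup>+s. block_mass s / m * ennreal (real (length s)) \<partial>count_space UNIV)"
    unfolding law by (subst nn_integral_density) auto
  also have "\<dots> = (\<integral>\<^sup>+s. 1 / (m * ennreal rho) * cut_mass 0 s \<partial>count_space UNIV)"
  proof (rule nn_integral_cong)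
    fix s
    have "0 \<le> block_mass s" by (simp add: block_mass_def pr_nonneg)
    then show "block_mass s / m * ennreal (real (length s)) = 1 / (m * ennreal rho) * cut_mass 0 s"
      using r rho by (simp add: cut_mass_def divide_ennreal ennreal_mult''[symmetric] ennreal_1[symmetric] del: ennreal_1)
  qed
  also have "\<dots> = 1 / (m * ennreal rho) * (\<integral>\<^sup>+s. cut_mass 0 s \<partial>count_space UNIV)"
    by (rule nn_integral_cmult) auto
  also have "\<dots> < \<infinity>"
    using Cut_marginal(2)[of 0] r rho
    by (auto simp: ennreal_mult_less_top ennreal_mult_eq_top_iff less_top[symmetric] ennreal_mult''[symmetric] ennreal_divide_eq_top_iff)
  finally show "(\<integral>\<^sup>+\<omega>. ennreal (norm (real (length (Cut i \<omega>)))) \<partial>M) < \<infinity>" .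
next
  show "(\<lambda>\<omega>. real (length (Cut i \<omega>))) \<in> borel_measurable M"
    by (rule measurable_compose[OF random_variable_Cut]) simp
qed

lemma renewal_times_eq:
  "renewal_times (\<lambda>j. if renews u j then 1 else 0) = renewal_time u"
proof -
  have "{j. (if renews u j then 1 else 0 :: nat) = 1} = {j. renews u j}" by auto
  then show ?thesis by (simp only: renewal_times_def renewal_time_def)
qed

abbreviation Gap :: "int \<Rightarrow> 'b \<Rightarrow> int" where
  "Gap i \<omega> \<equiv> renewal_time (\<lambda>n. U n \<omega>) (i + 1) - renewal_time (\<lambda>n. U n \<omega>) i"

lemma random_variable_Gap: "random_variable (count_space UNIV) (Gap i)"
  by (rule measurable_compose[OF random_variable_seq]) measurable

lemma AE_Gap: "AE \<omega> in M. int (length (Cut i \<omega>)) = Gap i \<omega>"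
  using AE_recurs
proof eventually_elim
  case (elim \<omega>)
  have "renewal_time (\<lambda>n. U n \<omega>) i < renewal_time (\<lambda>n. U n \<omega>) (i + 1)"
    using renewal_time_enumerates[OF elim] by (simp add: enumerates_def)
  then show ?case by (simp add: cut_def)
qed

theorem renewal_renews: "renewal (\<lambda>j \<omega>. if renews (\<lambda>n. U n \<omega>) j then 1 else 0)"
  unfolding renewal_def renewal_times_eq
proof (intro conjI allI ballI)
  fix j
  show "random_variable (count_space UNIV) (\<lambda>\<omega>. if renews (\<lambda>n. U n \<omega>) j then 1 else 0 :: nat)"
    using pred_seq[OF pred_renews[of j]] by measurable
next
  have "{j. (if renews u j then 1 else 0 :: nat) = 1} = {j. renews u j}" for u by auto
  then show "AE \<omega> in M. \<exists>T. enumerates T {j. (if renews (\<lambda>n. U n \<omega>) j then 1 else 0 :: nat) = 1}"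
    using AE_recurs by (simp only: recurs_def)
next
  have "indep_vars (\<lambda>_. count_space UNIV) (\<lambda>i \<omega>. int (length (Cut i \<omega>))) UNIV"
    by (rule indep_vars_compose2[OF indep_Cut]) simp
  then show "indep_vars (\<lambda>_. count_space UNIV) Gap UNIV"
    by (rule indep_vars_cong_AE) (use random_variable_Gap AE_Gap in auto)
next
  have law: "distr M (count_space UNIV) (Gap i) = distr (distr M (count_space UNIV) (Cut i)) (count_space UNIV) (\<lambda>s. int (length s))" for i
  proof -
    have "distr M (count_space UNIV) (Gap i) = distr M (count_space UNIV) (\<lambda>\<omega>. int (length (Cut i \<omega>)))"
    proof (rule distr_cong_AE)
      show "AE \<omega> in M. Gap i \<omega> = int (length (Cut i \<omega>))"
        using AE_Gap[of i] by eventually_elim simp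
      show "random_variable (count_space UNIV) (\<lambda>\<omega>. int (length (Cut i \<omega>)))"
        by (rule measurable_compose[OF random_variable_Cut]) simp
    qed (simp_all add: random_variable_Gap)
    also have "\<dots> = distr (distr M (count_space UNIV) (Cut i)) (count_space UNIV) (\<lambda>s. int (length s))"
      by (subst distr_distr[OF _ random_variable_Cut]) (simp_all only: comp_def measurable_count_space)
    finally show ?thesis .
  qed
  show "ident_distr {i. i \<noteq> 0} (count_space UNIV) Gap"
    unfolding ident_distr_def
  proof (intro ballI)
    fix i j :: int assume ij: "i \<in> {i. i \<noteq> 0}" "j \<in> {i. i \<noteq> 0}"
    have "distr M (count_space UNIV) (Cut i) = distr M (count_space UNIV) (Cut j)"
      using ident_distr_Cut ij unfolding ident_distr_def by blast
    then show "distr M (count_space UNIV) (Gap i) = distr M (count_space UNIV) (Gap j)"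
      unfolding law[of i] law[of j] by (rule arg_cong)
  qed
qed auto

end

section \<open>The update function of a context tree\<close>

lemma is_suffix_linear:
  "is_suffix v1 s \<Longrightarrow> is_suffix v2 s \<Longrightarrow> slen v1 \<le> slen v2 \<Longrightarrow> is_suffix v1 v2"
  unfolding is_suffix_def by (metis order_less_le_trans)

lemma is_suffix_append: "is_suffix v (Finite s) \<Longrightarrow> is_suffix v (Finite (t @ s))"
  unfolding is_suffix_def
proof (elim conjE, intro conjI allI impI)
  assume len: "slen v \<le> slen (Finite s)"
  show "slen v \<le> slen (Finite (t @ s))" by (rule order.trans[OF len]) simp
  fix j assume "enat j < slen v" "\<forall>j. enat j < slen v \<longrightarrow> sym (Finite s) j = sym v j"
  moreover have "j < length s" using len \<open>enat j < slen v\<close> by (metis enat_ord_simps(2) order_less_le_trans slen.simps(1))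
  ultimately show "sym (Finite (t @ s)) j = sym v j" by (simp add: nth_append)
qed

locale labelled_tree =
  fixes A :: "nat set" and \<tau> :: "nat str set" and p :: "nat str \<Rightarrow> nat pmf" and \<epsilon> :: real
  assumes pct: "prob_context_tree A \<tau> p"
    and unbounded: "unbounded_tree \<tau>"
    and eps_pos: "0 < \<epsilon>"
    and labels: "labelled A (regular_symbols A \<tau> p \<epsilon>)"
begin

abbreviation E :: "nat set" where
  "E \<equiv> regular_symbols A \<tau> p \<epsilon>"

lemma is_tree: "s \<in> \<tau> \<Longrightarrow> v \<in> \<tau> \<Longrightarrow> is_suffix s v \<Longrightarrow> s = v"
  using pct by (auto simp: prob_context_tree_def context_tree_def tree_def)

lemma infinite_past_suffix: "range x \<subseteq> A \<Longrightarrow> \<exists>v\<in>\<tau>. is_suffix v (Infinite x)"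
  using pct by (auto simp: prob_context_tree_def context_tree_def infinite_pasts_def)

lemma one_in_A: "1 \<in> A" and A_ge_1: "a \<in> A \<Longrightarrow> 1 \<le> a"
  using labels by (auto simp: labelled_def)

lemma E_eq: "E = {1..card E}"
  using labels by (simp add: labelled_def)

lemma finite_E: "finite E"
  by (subst E_eq) simp

lemma mem_E_iff: "a \<in> E \<longleftrightarrow> 1 \<le> a \<and> a \<le> card E"
  by (subst E_eq) simp

lemma E_subset: "E \<subseteq> A"
  by (auto simp: regular_symbols_def)

lemma regular_le: "a \<in> E \<Longrightarrow> v \<in> \<tau> \<Longrightarrow> \<epsilon> \<le> pmf (p v) a"
proof -
  assume "a \<in> E" "v \<in> \<tau>"
  then have "\<epsilon> \<le> (INF v\<in>\<tau>. pmf (p v) a)" by (simp add: regular_symbols_def)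
  also have "\<dots> \<le> pmf (p v) a" using \<open>v \<in> \<tau>\<close> by (intro cINF_lower bdd_belowI2[of _ 0]) auto
  finally show ?thesis .
qed

lemma Nil_notin: "Finite [] \<notin> \<tau>"
proof
  assume "Finite [] \<in> \<tau>"
  moreover have "is_suffix (Finite []) v" for v :: "nat str" by (simp add: is_suffix_def zero_enat_def[symmetric])
  ultimately have "\<tau> = {Finite []}" using is_tree by blast
  then show False using unbounded by (simp add: unbounded_tree_def)
qed

lemma ctx_eq: "v \<in> \<tau> \<Longrightarrow> is_suffix v s \<Longrightarrow> ctx \<tau> s = v"
proof -
  assume v: "v \<in> \<tau>" "is_suffix v s"
  have "v' = v" if "v' \<in> \<tau>" "is_suffix v' s" for v'
    using is_suffix_linear[OF v(2) that(2)] is_suffix_linear[OF that(2) v(2)]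
      is_tree[OF v(1) that(1)] is_tree[OF that(1) v(1)] linear[of "slen v" "slen v'"] by auto
  then have "(THE v. v \<in> \<tau> \<and> is_suffix v s) = v" using v by blast
  moreover have "\<exists>v\<in>\<tau>. is_suffix v s" using v by blast
  ultimately show ?thesis by (simp only: ctx_def if_True)
qed

lemma ctx_Nil: "\<forall>v\<in>\<tau>. \<not> is_suffix v s \<Longrightarrow> ctx \<tau> s = Finite []"
  by (auto simp: ctx_def)

lemma regular_mass_le: "real (card E) * \<epsilon> \<le> 1"
proof -
  obtain v where v: "v \<in> \<tau>" using infinite_past_suffix[of "\<lambda>_. 1"] one_in_A by auto
  have "real (card E) * \<epsilon> = (\<Sum>a\<in>E. \<epsilon>)" by simp
  also have "\<dots> \<le> (\<Sum>a\<in>E. pmf (p v) a)" by (intro sum_mono regular_le v)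
  also have "\<dots> = measure (p v) E" by (simp add: measure_measure_pmf_finite finite_E)
  finally show ?thesis using measure_pmf.prob_le_1[of "p v" E] by linarith
qed

subsection \<open>The partition of the unit interval\<close>

text \<open>
  Both kinds of intervals \<^const>\<open>J\<close> lie between consecutive values of this single increasing function, which
  starts at \<open>card E * \<epsilon>\<close> and tends to \<open>1\<close>: at a regular symbol it grows by \<open>p(a|v) - \<epsilon>\<close> only, since the
  mass \<open>\<epsilon>\<close> is already in \<^const>\<open>J_empty\<close>.
\<close>

definition level :: "nat str \<Rightarrow> nat \<Rightarrow> real" where
  "level v a = (\<Sum>i=1..a. pmf (p v) i) + \<epsilon> * real (card E - a)"

lemma J_eq_level:
  assumes "a \<in> A"
  shows "J A \<tau> p \<epsilon> a v = {level v (a - 1)..<level v a}"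
proof -
  obtain b where a: "a = Suc b" using A_ge_1[OF assms] by (cases a) auto
  have ivl: "{1..<Suc b} = {1..b}" by auto
  show ?thesis
  proof (cases "a \<in> E")
    case True
    then have "Suc b \<le> card E" using mem_E_iff[of a] a by simp
    then show ?thesis
      using True unfolding J_def Let_def level_def a
      by (simp add: ivl[simplified] sum_subtractf of_nat_diff algebra_simps)
  next
    case False
    then have "card E \<le> b" using mem_E_iff[of a] a by simp
    then show ?thesis
      using False unfolding J_def Let_def level_def a by (simp add: ivl[simplified])
  qed
qed

lemma level_mono:
  assumes "v \<in> \<tau>" "a \<le> b"
  shows "level v a \<le> level v b"
proof (rule lift_Suc_mono_le[OF _ assms(2)])
  fix n
  show "level v n \<le> level v (Suc n)"
  proof (cases "Suc n \<le> card E")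
    case True
    then have "\<epsilon> \<le> pmf (p v) (Suc n)" by (intro regular_le assms(1)) (simp add: mem_E_iff)
    moreover have "real (card E - n) = real (card E - Suc n) + 1" using True by simp
    ultimately show ?thesis by (simp add: level_def algebra_simps)
  qed (simp add: level_def)
qed

lemma level_0: "level v 0 = real (card E) * \<epsilon>"
  by (simp add: level_def)

lemma J_empty_less: "a \<in> E \<Longrightarrow> x \<in> J_empty \<epsilon> a \<Longrightarrow> x < real (card E) * \<epsilon>"
proof -
  assume "a \<in> E" "x \<in> J_empty \<epsilon> a"
  moreover have "real a * \<epsilon> \<le> real (card E) * \<epsilon>"
    using \<open>a \<in> E\<close> eps_pos by (intro mult_right_mono) (auto simp: mem_E_iff)
  ultimately show ?thesis by (simp add: J_empty_def)
qed

lemma J_empty_unique: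
  assumes "x \<in> J_empty \<epsilon> a" "x \<in> J_empty \<epsilon> b"
  shows "a = b"
proof -
  have "(real a - 1) * \<epsilon> < real b * \<epsilon>" "(real b - 1) * \<epsilon> < real a * \<epsilon>"
    using assms by (auto simp: J_empty_def)
  then have "real a - 1 < real b" "real b - 1 < real a" using eps_pos by auto
  then show ?thesis by linarith
qed

lemma K_unique:
  assumes v: "v \<in> \<tau>" and "a \<in> A" "b \<in> A" "x \<in> K A \<tau> p \<epsilon> a v" "x \<in> K A \<tau> p \<epsilon> b v"
  shows "a = b"
proof -
  have low: "real (card E) * \<epsilon> \<le> x" if "c \<in> A" "x \<in> J A \<tau> p \<epsilon> c v" for c
    using that level_mono[OF v, of 0 "c - 1"] by (simp add: J_eq_level level_0)
  have "\<not> (x \<in> J A \<tau> p \<epsilon> c v \<and> x \<in> J A \<tau> p \<epsilon> d v)" if "c \<in> A" "d \<in> A" "c < d" for c d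
    using that level_mono[OF v, of c "d - 1"] by (simp add: J_eq_level) linarith
  then have J: "a = b" if "x \<in> J A \<tau> p \<epsilon> a v" "x \<in> J A \<tau> p \<epsilon> b v"
    using that assms(2,3) by (metis linorder_neqE_nat)
  show ?thesis
    using assms(2-5) low J J_empty_less J_empty_unique unfolding K_def
    by (auto split: if_splits) (metis not_less)+
qed

lemma K_exists:
  assumes v: "v \<in> \<tau>" and x: "0 \<le> x" "x < 1"
  shows "\<exists>a\<in>A. x \<in> K A \<tau> p \<epsilon> a v"
proof (cases "x < real (card E) * \<epsilon>")
  case True
  define a where "a = nat \<lfloor>x / \<epsilon>\<rfloor> + 1"
  have "0 \<le> x / \<epsilon>" using x eps_pos by simp
  then have "real a - 1 \<le> x / \<epsilon>" "x / \<epsilon> < real a" unfolding a_def by linarith+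
  then have J: "x \<in> J_empty \<epsilon> a" using eps_pos by (simp add: J_empty_def field_simps)
  then have "(real a - 1) * \<epsilon> < real (card E) * \<epsilon>" using True by (simp add: J_empty_def)
  then have "real a - 1 < real (card E)" using eps_pos by simp
  then have "a \<in> E" unfolding mem_E_iff a_def by linarith
  then show ?thesis using J E_subset by (auto simp: K_def)
next
  case False
  have sum_le: "(\<Sum>i=1..a. pmf (p v) i) \<le> level v a" for a
    using eps_pos by (simp add: level_def)
  have supp: "set_pmf (p v) \<subseteq> A" using pct v by (simp add: prob_context_tree_def)
  have p0: "pmf (p v) i = 0" if "i \<notin> A" for i
    using that supp by (auto simp: set_pmf_eq)
  have "(\<lambda>a. measure (p v) {1..a}) \<longlonglongrightarrow> measure (p v) (\<Union>a. {1..a})"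
    by (intro measure_pmf.finite_Lim_measure_incseq) (auto simp: incseq_def)
  moreover have "measure (p v) (\<Union>a. {1..a}) = 1"
  proof -
    have "set_pmf (p v) \<subseteq> (\<Union>a. {1..a})" using supp A_ge_1 by fastforce
    then show ?thesis by (intro measure_pmf.prob_eq_1[THEN iffD2]) (auto simp: AE_measure_pmf_iff)
  qed
  ultimately have "(\<lambda>a. \<Sum>i=1..a. pmf (p v) i) \<longlonglongrightarrow> 1"
    by (simp add: measure_measure_pmf_finite)
  then have "eventually (\<lambda>a. x < (\<Sum>i=1..a. pmf (p v) i)) sequentially"
    using x(2) by (rule order_tendstoD(1))
  then obtain a0 where "x < level v a0" using sum_le by (auto simp: eventually_sequentially intro: less_le_trans)
  define a where "a = (LEAST a. x < level v a)"
  have a: "x < level v a" unfolding a_def by (rule LeastI[of _ a0]) fact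
  have "a \<noteq> 0" using a False by (metis level_0)
  then have below: "level v (a - 1) \<le> x"
    using not_less_Least[of "a - 1" "\<lambda>a. x < level v a"] by (simp add: a_def)
  have "a \<in> A"
  proof (rule ccontr)
    assume "a \<notin> A"
    then have "a \<notin> E" using E_subset by auto
    then have "card E - a = 0" "card E - (a - 1) = 0" using \<open>a \<noteq> 0\<close> by (auto simp: mem_E_iff)
    then have "level v a = level v (a - 1)"
      using p0[OF \<open>a \<notin> A\<close>] \<open>a \<noteq> 0\<close> by (cases a) (simp_all add: level_def)
    then show False using a below by simp
  qed
  then have "x \<in> J A \<tau> p \<epsilon> a v" using a below by (simp add: J_eq_level)
  then show ?thesis using \<open>a \<in> A\<close> by (auto simp: K_def)
qed

lemma borel_K: "a \<in> A \<Longrightarrow> K A \<tau> p \<epsilon> a v \<in> sets borel"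
  unfolding K_def by (auto simp: J_empty_def J_eq_level)

subsection \<open>Monotonicity of the update function\<close>

text \<open>
  Outside the unit interval the value of \<^const>\<open>F\<close> need not be a symbol; such values are counted as
  undetermined here, as in the definition of \<^const>\<open>L\<close>.
\<close>

definition update :: "real \<Rightarrow> nat list \<Rightarrow> nat option" where
  "update x s = (case F A \<tau> p \<epsilon> x (Finite s) of Some a \<Rightarrow> if a \<in> A then Some a else None | None \<Rightarrow> None)"

lemma update_eq_Some: "update x s = Some a \<longleftrightarrow> F A \<tau> p \<epsilon> x (Finite s) = Some a \<and> a \<in> A"
  by (auto simp: update_def split: option.splits)

lemma F_context:
  assumes "v \<in> \<tau>" "is_suffix v s"
  shows "F A \<tau> p \<epsilon> x s = Some (THE a. a \<in> A \<and> x \<in> K A \<tau> p \<epsilon> a v)"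
proof -
  have "v \<noteq> Finite []" using Nil_notin assms(1) by auto
  then show ?thesis unfolding F_def ctx_eq[OF assms] by simp
qed

lemma F_no_context:
  assumes "\<forall>v\<in>\<tau>. \<not> is_suffix v s"
  shows "F A \<tau> p \<epsilon> x s = Some a \<longleftrightarrow> a \<in> E \<and> x \<in> J_empty \<epsilon> a"
proof -
  have "(THE a. a \<in> E \<and> x \<in> J_empty \<epsilon> a) = b" if "b \<in> E" "x \<in> J_empty \<epsilon> b" for b
    using that J_empty_unique by blast
  then show ?thesis unfolding F_def ctx_Nil[OF assms] by auto
qed

text \<open>
  The initial intervals belong to the regular symbols whatever the context is. This is the reason for
  monotonicity in the case that longer strings have a context and the given one has none.
\<close>

lemma update_regular:
  assumes "a \<in> E" "x \<in> J_empty \<epsilon> a"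
  shows "update x s = Some a"
proof (cases "\<exists>v\<in>\<tau>. is_suffix v (Finite s)")
  case True
  then obtain v where v: "v \<in> \<tau>" "is_suffix v (Finite s)" by auto
  have a: "a \<in> A" "x \<in> K A \<tau> p \<epsilon> a v" using assms E_subset by (auto simp: K_def)
  then have "(THE a. a \<in> A \<and> x \<in> K A \<tau> p \<epsilon> a v) = a" using K_unique[OF v(1)] by blast
  then show ?thesis using a by (simp add: update_eq_Some F_context[OF v])
next
  case False
  then show ?thesis using assms E_subset by (auto simp: update_eq_Some F_no_context)
qed

lemma update_context:
  assumes "v \<in> \<tau>" "is_suffix v (Finite s)" "0 \<le> x" "x < 1"
  shows "\<exists>a. update x s = Some a"
proof -
  obtain a where a: "a \<in> A" "x \<in> K A \<tau> p \<epsilon> a v" using K_exists[OF assms(1,3,4)] by auto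
  then have "(THE a. a \<in> A \<and> x \<in> K A \<tau> p \<epsilon> a v) = a" using K_unique[OF assms(1)] by blast
  then show ?thesis using a by (simp add: update_eq_Some F_context[OF assms(1,2)])
qed

lemma update_append: "update x s = Some a \<Longrightarrow> update x (t @ s) = Some a"
proof (cases "\<exists>v\<in>\<tau>. is_suffix v (Finite s)")
  case True
  then obtain v where v: "v \<in> \<tau>" "is_suffix v (Finite s)" by auto
  assume "update x s = Some a"
  then show ?thesis
    by (simp add: update_eq_Some F_context[OF v] F_context[OF v(1) is_suffix_append[OF v(2)]])
next
  case False
  assume "update x s = Some a"
  then have "a \<in> E" "x \<in> J_empty \<epsilon> a" using False by (simp_all add: update_eq_Some F_no_context)
  then show ?thesis by (rule update_regular)
qed

text \<open>
  If there is a context, either exactly one symbol is possible, or none; in the latter case the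
  description is of the constantly false predicate, and its value does not depend on \<open>x\<close>.
\<close>

lemma borel_update: "{x. update x s = Some a} \<in> sets borel"
proof (cases "\<exists>v\<in>\<tau>. is_suffix v (Finite s)")
  case True
  then obtain v where v: "v \<in> \<tau>" "is_suffix v (Finite s)" by auto
  have the: "(THE b. b \<in> A \<and> x \<in> K A \<tau> p \<epsilon> b v) = a \<longleftrightarrow>
      x \<in> K A \<tau> p \<epsilon> a v \<or> ((\<forall>b\<in>A. x \<notin> K A \<tau> p \<epsilon> b v) \<and> a = (THE b. False))" if "a \<in> A" for x
  proof (cases "\<exists>b\<in>A. x \<in> K A \<tau> p \<epsilon> b v")
    case True
    then obtain b where b: "b \<in> A" "x \<in> K A \<tau> p \<epsilon> b v" by auto
    then have "(THE b. b \<in> A \<and> x \<in> K A \<tau> p \<epsilon> b v) = b" using K_unique[OF v(1)] by blast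
    then show ?thesis using b that K_unique[OF v(1)] by auto
  next
    case False
    then have "(\<lambda>b. b \<in> A \<and> x \<in> K A \<tau> p \<epsilon> b v) = (\<lambda>b. False)" by auto
    then show ?thesis using False that by auto
  qed
  show ?thesis
  proof (cases "a \<in> A")
    case True
    then have "{x. update x s = Some a} =
        K A \<tau> p \<epsilon> a v \<union> (if a = (THE b. False) then - (\<Union>b\<in>A. K A \<tau> p \<epsilon> b v) else {})"
      using the by (auto simp: update_eq_Some F_context[OF v])
    also have "\<dots> \<in> sets borel"
      using True borel_K by (auto intro!: sets.Un borel_comp sets.countable_UN' simp del: Compl_UN)
    finally show ?thesis .
  qed (simp add: update_eq_Some)
next
  case False
  then have "{x. update x s = Some a} = (if a \<in> E \<inter> A then J_empty \<epsilon> a else {})"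
    by (auto simp: update_eq_Some F_no_context)
  then show ?thesis by (simp add: J_empty_def)
qed

sublocale monotone_update update
  by standard (use update_append borel_update in auto)

section \<open>Coalescence times and the chain\<close>

lemma L_Fin: "L A \<tau> p \<epsilon> u m (Fin n) \<longleftrightarrow> alive u m (nat (n - m + 1))"
proof
  assume "L A \<tau> p \<epsilon> u m (Fin n)"
  then obtain a where a: "\<And>i. m \<le> i \<Longrightarrow> i \<le> n \<Longrightarrow> update (u i) (map a [m..i - 1]) = Some (a i)"
    unfolding L_def update_eq_Some by auto
  have "produces u m (map a [m..n])"
    unfolding produces_def
  proof (intro allI impI)
    fix i assume "i < length (map a [m..n])"
    then have i: "m + int i \<le> n" by simp
    then have "take i (map a [m..n]) = map a [m..m + int i - 1]"
      by (intro nth_equalityI) auto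
    then show "update (u (m + int i)) (take i (map a [m..n])) = Some (map a [m..n] ! i)"
      using a[of "m + int i"] i by simp
  qed
  then show "alive u m (nat (n - m + 1))" unfolding alive_def by (intro exI[of _ "map a [m..n]"]) simp
next
  assume "alive u m (nat (n - m + 1))"
  then obtain s where s: "length s = nat (n - m + 1)" "produces u m s" by (auto simp: alive_def)
  have "update (u i) (map (\<lambda>j. s ! nat (j - m)) [m..i - 1]) = Some (s ! nat (i - m))" if "m \<le> i" "i \<le> n" for i
  proof -
    have "map (\<lambda>j. s ! nat (j - m)) [m..i - 1] = take (nat (i - m)) s"
      using that s(1) by (intro nth_equalityI) auto
    moreover have "nat (i - m) < length s" "m + int (nat (i - m)) = i" using that s(1) by auto
    ultimately show ?thesis using s(2) unfolding produces_def by metis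
  qed
  then show "L A \<tau> p \<epsilon> u m (Fin n)"
    unfolding L_def update_eq_Some by (intro exI[of _ "\<lambda>j. s ! nat (j - m)"]) auto
qed

lemma L_Pinf: "L A \<tau> p \<epsilon> u m Pinf \<longleftrightarrow> renews u m"
proof
  assume "L A \<tau> p \<epsilon> u m Pinf"
  then have "L A \<tau> p \<epsilon> u m (Fin n)" for n unfolding L_def by auto
  then have "alive u m (nat (m + int j - m + 1))" for j unfolding L_Fin .
  then have "alive u m (Suc j)" for j by (simp add: nat_add_distrib)
  then show "renews u m" unfolding renews_def using alive_le le_SucI order_refl by metis
next
  assume "renews u m"
  then have "\<forall>j. \<exists>s. length s = j \<and> produces u m s" by (simp add: renews_def alive_def)
  then obtain s where s: "length (s j) = j" "produces u m (s j)" for j by metis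
  define a where "a j = s (nat (j - m + 1)) ! nat (j - m)" for j
  have pre: "a (m + int k) = s j ! k" if "k < j" for j k
    using produces_prefix[OF s(2)[of "Suc k"] s(2)[of j]] that by (simp add: s(1) a_def nat_add_distrib)
  have "update (u i) (map a [m..i - 1]) = Some (a i)" if "m \<le> i" for i
  proof -
    define k where "k = nat (i - m)"
    have i: "i = m + int k" using that by (simp add: k_def)
    have "map a [m..i - 1] = take k (s (Suc k))"
      using that by (intro nth_equalityI) (auto simp: s(1) i pre[of _ "Suc k"])
    then show ?thesis using s(2)[of "Suc k"] pre[of k "Suc k"] s(1) unfolding produces_def i by auto
  qed
  then show "L A \<tau> p \<epsilon> u m Pinf" unfolding L_def update_eq_Some by (intro exI[of _ a]) auto
qed

lemma theta_exists:
  assumes "k \<le> m" "L A \<tau> p \<epsilon> u k n"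
  shows "\<exists>k'. theta A \<tau> p \<epsilon> u m n = Fin k' \<and> k \<le> k' \<and> k' \<le> m \<and> L A \<tau> p \<epsilon> u k' n"
proof -
  define B where "B = {j\<in>{k..m}. L A \<tau> p \<epsilon> u j n}"
  have "B \<subseteq> {k..m}" by (auto simp: B_def)
  then have B: "finite B" "k \<in> B" using assms finite_subset by (auto simp: B_def)
  have "Max B \<in> B" using B by (intro Max_in) auto
  moreover have "(GREATEST j. j \<le> m \<and> L A \<tau> p \<epsilon> u j n) = Max B"
  proof (rule Greatest_equality)
    show "Max B \<le> m \<and> L A \<tau> p \<epsilon> u (Max B) n" using \<open>Max B \<in> B\<close> by (auto simp: B_def)
    fix j assume j: "j \<le> m \<and> L A \<tau> p \<epsilon> u j n"
    show "j \<le> Max B"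
    proof (cases "k \<le> j")
      case True
      then show ?thesis using j B(1) by (intro Max_ge) (auto simp: B_def)
    next
      case False
      then show ?thesis using \<open>Max B \<in> B\<close> by (auto simp: B_def)
    qed
  qed
  ultimately show ?thesis using assms unfolding theta_def by (auto simp: B_def)
qed

lemma theta_FinD:
  assumes "theta A \<tau> p \<epsilon> u m n = Fin k"
  shows "k \<le> m" "L A \<tau> p \<epsilon> u k n"
proof -
  obtain j where "j \<le> m" "L A \<tau> p \<epsilon> u j n" using assms by (auto simp: theta_def split: if_splits)
  from theta_exists[OF this] show "k \<le> m" "L A \<tau> p \<epsilon> u k n" using assms by auto
qed

lemma xi_eq: "xi A \<tau> p \<epsilon> u j = (if renews u j then 1 else 0)"
  using theta_exists[of j j u Pinf] theta_FinD[of u j Pinf j] unfolding xi_def L_Pinf by auto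

lemma gen_eq: "produces u m s \<Longrightarrow> gen A \<tau> p \<epsilon> u m (length s) = s"
proof (induction s rule: rev_induct)
  case (snoc a s)
  then show ?case by (simp add: produces_snoc update_eq_Some)
qed simp

text \<open>
  The window that consists of the time \<open>i\<close> alone already yields a symbol at \<open>i\<close> whenever some window
  does, and by coalescence all the windows yield the same one.
\<close>

lemma chain_eq_symbol: "chain A \<tau> p \<epsilon> u i = symbol u i"
proof -
  have symbol_at: "symbol_at u i (gen A \<tau> p \<epsilon> u k (nat (i - k) + 1) ! nat (i - k))"
    if le: "k \<le> i" and al: "alive u k (nat (i - k) + 1)" for k
  proof -
    obtain s where s: "length s = nat (i - k) + 1" "produces u k s" using al unfolding alive_def by blast
    then have "s \<noteq> []" by auto
    have "gen A \<tau> p \<epsilon> u k (nat (i - k) + 1) = s" using gen_eq[OF s(2)] s(1) by simp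
    moreover have "s ! nat (i - k) = last s" using s(1) \<open>s \<noteq> []\<close> by (simp add: last_conv_nth)
    moreover have "symbol_at u i (last s)"
      unfolding symbol_at_def using s \<open>s \<noteq> []\<close> le by (intro exI[of _ k] exI[of _ "butlast s"]) auto
    ultimately show ?thesis by simp
  qed
  have "(\<exists>m n k. Fin m \<le> n \<and> theta A \<tau> p \<epsilon> u m n = Fin k \<and> k \<le> i \<and> Fin i \<le> n \<and>
      a = gen A \<tau> p \<epsilon> u k (nat (i - k) + 1) ! nat (i - k)) \<longleftrightarrow> symbol_at u i a" for a
  proof
    assume "\<exists>m n k. Fin m \<le> n \<and> theta A \<tau> p \<epsilon> u m n = Fin k \<and> k \<le> i \<and> Fin i \<le> n \<and>
      a = gen A \<tau> p \<epsilon> u k (nat (i - k) + 1) ! nat (i - k)"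
    then obtain m n k where k: "theta A \<tau> p \<epsilon> u m n = Fin k" "k \<le> i" "Fin i \<le> n"
      and a: "a = gen A \<tau> p \<epsilon> u k (nat (i - k) + 1) ! nat (i - k)" by blast
    have "L A \<tau> p \<epsilon> u k n" using theta_FinD(2)[OF k(1)] .
    then have "L A \<tau> p \<epsilon> u k (Fin i)" using k(3) unfolding L_def by (meson order_trans less_eq_extended.simps(1))
    then have "alive u k (nat (i - k) + 1)" using k(2) unfolding L_Fin by (simp add: nat_add_distrib)
    then show "symbol_at u i a" unfolding a using k(2) by (intro symbol_at)
  next
    assume a: "symbol_at u i a"
    then obtain k s where s: "produces u k (s @ [a])" "k + int (length s) = i" by (auto simp: symbol_at_def)
    then have "alive u k (nat (i - k + 1))" unfolding alive_def by (intro exI[of _ "s @ [a]"]) auto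
    then obtain k' where k': "theta A \<tau> p \<epsilon> u i (Fin i) = Fin k'" "k' \<le> i" "L A \<tau> p \<epsilon> u k' (Fin i)"
      using theta_exists[of k i u "Fin i"] s(2) by (auto simp: L_Fin)
    then have "alive u k' (nat (i - k') + 1)" by (simp add: L_Fin nat_add_distrib)
    then have "a = gen A \<tau> p \<epsilon> u k' (nat (i - k') + 1) ! nat (i - k')"
      using symbol_at[OF k'(2)] a symbol_at_unique by blast
    then show "\<exists>m n k. Fin m \<le> n \<and> theta A \<tau> p \<epsilon> u m n = Fin k \<and> k \<le> i \<and> Fin i \<le> n \<and>
      a = gen A \<tau> p \<epsilon> u k (nat (i - k) + 1) ! nat (i - k)"
      using k' by (intro exI[of _ i] exI[of _ "Fin i"] exI[of _ k']) auto
  qed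
  then show ?thesis unfolding chain_def symbol_def by simp
qed

end

section \<open>Positive probability of a renewal\<close>

text \<open>
  Let \<open>c < 1\<close> be a bound on the upper limit, with some space left. A context in which the
  reference string last occurs at distance \<open>j\<close> from the end has length at most \<open>exp (c * C * j)\<close> for large \<open>j\<close>. So it fits into \<open>i\<close> symbols if
  \<open>j \<le> ln i / (c * C)\<close>, which is the window of \<open>r i\<close> blocks of length \<open>d\<close>. If a block fails
  to contain the reference string with probability \<open>exp (- C * d)\<close>, all the blocks of this window fail
  with probability of order \<open>i powr (- 1 / c)\<close>, and this is summable because \<open>c < 1\<close>.
\<close>

lemma waiting_windows:
  fixes l :: "nat \<Rightarrow> nat" and C :: real and d :: nat
  assumes C: "0 < C" and d: "0 < d"
    and growth: "limsup (\<lambda>k. elog (l k) / ereal (C * real k)) < 1"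
  obtains r N0 where "\<And>i j. N0 \<le> i \<Longrightarrow> j \<le> r i * d \<Longrightarrow> j + d + l j \<le> i"
    and "summable (\<lambda>i. exp (- C * real d) ^ r i)"
proof -
  obtain c0 where c0: "limsup (\<lambda>k. elog (l k) / ereal (C * real k)) < ereal c0" "c0 < 1"
    using ereal_dense2[OF growth] by auto
  \<comment> \<open>\<open>c1\<close> is positive, and the space between \<open>c1\<close> and \<open>c\<close> absorbs the linear term \<open>k + d\<close>.\<close>
  define c1 where "c1 = max c0 (1/2)"
  define c where "c = (1 + c1) / 2"
  have c: "0 < c1" "c1 < c" "c < 1" "c0 \<le> c1" using c0(2) by (auto simp: c_def c1_def max_def)
  have "eventually (\<lambda>k. elog (l k) / ereal (C * real k) < ereal c0) sequentially"
    by (rule Limsup_lessD) fact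
  then have "eventually (\<lambda>k. real (l k) \<le> exp (c1 * C * real k)) sequentially"
    using eventually_gt_at_top[of 0]
  proof eventually_elim
    case (elim k)
    show ?case
    proof (cases "l k = 0")
      case False
      have "0 < C * real k" using C elim by simp
      then have "ln (real (l k)) / (C * real k) < c0" using elim False C by (simp add: elog_def)
      then have "ln (real (l k)) < c0 * (C * real k)" using \<open>0 < C * real k\<close> by (simp add: field_simps)
      also have "\<dots> \<le> c1 * (C * real k)" using c \<open>0 < C * real k\<close> by (intro mult_right_mono) auto
      finally show ?thesis using False by (subst ln_le_cancel_iff[symmetric]) (auto simp: mult.assoc)
    qed simp
  qed
  moreover have "eventually (\<lambda>k. real k + real d + exp (c1 * C * real k) \<le> exp (c * C * real k)) sequentially"
  proof -
    define a b where "a = c1 * C" and "b = c * C"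
    have "0 < a" "a < b" using c C by (auto simp: a_def b_def)
    then have "eventually (\<lambda>k. real k + real d + exp (a * real k) \<le> exp (b * real k)) sequentially"
      by real_asymp
    then show ?thesis by (simp add: a_def b_def)
  qed
  ultimately have "eventually (\<lambda>k. real (k + d + l k) \<le> exp (c * C * real k)) sequentially"
    by eventually_elim simp
  then obtain k0 where k0: "\<And>k. k0 \<le> k \<Longrightarrow> real (k + d + l k) \<le> exp (c * C * real k)"
    by (auto simp: eventually_sequentially)
  define b where "b = c * C"
  have b: "0 < b" using c C by (simp add: b_def)
  define r where "r i = nat \<lfloor>ln (real i) / (b * real d)\<rfloor>" for i
  have r_le: "real (r i) \<le> ln (real i) / (b * real d)" if "1 \<le> i" for i
  proof -
    have "0 \<le> ln (real i) / (b * real d)" using that b d by (intro divide_nonneg_pos) auto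
    then show ?thesis by (simp add: r_def)
  qed
  show ?thesis
  proof (rule that)
    fix i j assume i: "max 1 (\<Sum>j<k0. j + d + l j) \<le> i" and j: "j \<le> r i * d"
    show "j + d + l j \<le> i"
    proof (cases "j < k0")
      case True
      then have "j + d + l j \<le> (\<Sum>j<k0. j + d + l j)"
        by (intro member_le_sum[of j "{..<k0}" "\<lambda>j. j + d + l j"]) auto
      then show ?thesis using i by simp
    next
      case False
      have "real j \<le> real (r i) * real d" using j by (metis of_nat_mono of_nat_mult)
      also have "\<dots> \<le> ln (real i) / (b * real d) * real d" using i r_le by (intro mult_right_mono) auto
      finally have "b * real j \<le> ln (real i)" using b d by (simp add: field_simps)
      then have "exp (b * real j) \<le> real i" using i by (metis exp_le_cancel_iff exp_ln max.bounded_iff of_nat_0_less_iff less_le_trans zero_less_one)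
      then have "real (j + d + l j) \<le> real i" using k0[of j] False by (simp add: b_def)
      then show ?thesis by (simp only: of_nat_le_iff)
    qed
  next
    have "summable (\<lambda>i. exp (C * real d) * real i powr (- (1 / c)))"
      using c by (intro summable_mult) (simp add: summable_real_powr_iff divide_less_eq)
    then show "summable (\<lambda>i. exp (- C * real d) ^ r i)"
    proof (rule summable_comparison_test'[where N = 1])
      fix i :: nat assume i: "1 \<le> i"
      have "ln (real i) / (b * real d) - 1 \<le> real (r i)" unfolding r_def by linarith
      then have "C * real d * (ln (real i) / (b * real d) - 1) \<le> C * real d * real (r i)"
        using C by (intro mult_left_mono) auto
      moreover have "C * real d * (ln (real i) / (b * real d) - 1) = ln (real i) / c - C * real d"
        using C c d by (simp add: b_def field_simps)
      ultimately have le: "- C * real d * real (r i) \<le> C * real d - ln (real i) / c" by simp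
      have "exp (- C * real d) ^ r i = exp (- C * real d * real (r i))"
        by (simp add: exp_of_nat2_mult[symmetric])
      also have "\<dots> \<le> exp (C * real d - ln (real i) / c)" using le by (subst exp_le_cancel_iff)
      also have "\<dots> = exp (C * real d) * real i powr (- (1 / c))"
        using i by (simp add: powr_def exp_add[symmetric])
      finally show "norm (exp (- C * real d) ^ r i) \<le> exp (C * real d) * real i powr (- (1 / c))"
        by simp
    qed
  qed
qed

locale reference_tree = labelled_tree +
  fixes w :: "nat list" and l :: "nat \<Rightarrow> nat"
  assumes eps_less: "\<epsilon> < 1"
    and regular: "regular_string A \<tau> p \<epsilon> w"
    and reference: "reference_string \<tau> w l"
    and growth: "limsup (\<lambda>k. elog (l k) / ereal (C_const \<epsilon> w * real k)) < 1"
begin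

lemma w_pos: "0 < length w"
  using reference by (simp add: reference_string_def)

lemma w_regular: "k < length w \<Longrightarrow> w ! k \<in> E"
  using regular by (auto simp: regular_string_def)

text \<open>
  Prolong \<open>s\<close> arbitrarily to an infinite past. Its context, if it were longer than \<open>s\<close>, would see the
  occurrence of \<open>w\<close> in \<open>s\<close>, and then its length would be given by \<open>l\<close> and be at most that of \<open>s\<close>.
\<close>

lemma context_exists:
  assumes s: "set s \<subseteq> A" and j: "j + length w \<le> length s"
    and occ: "\<And>k. k < length w \<Longrightarrow> s ! (length s - j - length w + k) = w ! k"
    and room: "\<And>m. m \<le> j \<Longrightarrow> m + length w + l m \<le> length s"
  shows "\<exists>v\<in>\<tau>. is_suffix v (Finite s)"
proof -
  define x where "x i = (if i < length s then rev s ! i else 1)" for i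
  have "x i \<in> A" for i
    using s one_in_A nth_mem[of i "rev s"] by (auto simp: x_def)
  then obtain v where v: "v \<in> \<tau>" "is_suffix v (Infinite x)" using infinite_past_suffix[of x] by blast
  have sym: "sym v i = x i" if "enat i < slen v" for i
    using v(2) that by (auto simp: is_suffix_def)
  have "slen v \<le> enat (length s)"
  proof (rule ccontr)
    assume "\<not> slen v \<le> enat (length s)"
    then have long: "enat (length s) < slen v" by simp
    have "substr v j (length w) = w"
    proof (rule nth_equalityI)
      fix k assume k: "k < length (substr v j (length w))"
      then have k: "k < length w" by (simp add: substr_def)
      define i where "i = j + length w - Suc k"
      have i: "i < length s" using j k by (simp add: i_def)
      have "substr v j (length w) ! k = sym v i"
        using k by (simp add: substr_def rev_nth i_def)
      also have "\<dots> = rev s ! i" using sym[of i] i long by (simp add: x_def) (metis enat_ord_simps(2) order_less_trans)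
      also have "\<dots> = s ! (length s - j - length w + k)"
        using i j k by (simp add: rev_nth i_def Suc_diff_Suc)
      finally show "substr v j (length w) ! k = w ! k" using occ k by simp
    qed (simp add: substr_def)
    moreover have "enat (j + length w) \<le> slen v" using j long by (metis enat_ord_simps(1) le_less_trans less_imp_le)
    ultimately have "first_occ w v \<le> enat j" unfolding first_occ_def by (intro Inf_lower) auto
    then obtain m where m: "first_occ w v = enat m" "m \<le> j" by (cases "first_occ w v") auto
    then have "slen v = enat (m + length w + l m)" using reference v(1) by (auto simp: reference_string_def)
    then show False using room[OF m(2)] long by simp
  qed
  moreover have "sym (Finite s) i = sym v i" if "enat i < slen v" for i
  proof -
    have "i < length s" using that \<open>slen v \<le> _\<close> by (metis enat_ord_simps(2) less_le_trans)
    then show ?thesis using sym[OF that] by (simp add: x_def)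
  qed
  ultimately have "is_suffix v (Finite s)" by (simp add: is_suffix_def)
  then show ?thesis using v(1) by blast
qed

text \<open>
  The noise alone makes \<open>w\<close> appear at \<open>i\<close>, whatever the past is.
\<close>

definition spelled :: "(int \<Rightarrow> real) \<Rightarrow> int \<Rightarrow> bool" where
  "spelled u i \<longleftrightarrow> (\<forall>k<length w. u (i + int k) \<in> J_empty \<epsilon> (w ! k))"

lemma produces_regular:
  assumes "produces u 0 s" "k < length s" "a \<in> E" "u (int k) \<in> J_empty \<epsilon> a"
  shows "s ! k = a"
  using assms update_regular[of a "u (int k)" "take k s"] by (simp add: produces_def)

lemma produces_subset: "produces u m s \<Longrightarrow> set s \<subseteq> A"
  by (auto simp: produces_def update_eq_Some in_set_conv_nth)

text \<open>
  The first \<open>N\<close> symbols are regular and so need no context. Later the string has a context as long as a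
  copy of \<open>w\<close> is within distance \<open>r i * length w\<close>. While this window still reaches back into the first
  \<open>N\<close> symbols, the last of the initial copies of \<open>w\<close> serves; afterwards \<open>spell\<close> provides one.
\<close>

lemma renews_from_spelling:
  assumes N: "N = R * length w" "0 < R"
    and unit: "\<And>i. 0 \<le> u i" "\<And>i. u i < 1"
    and start: "\<And>k. k < N \<Longrightarrow> u (int k) \<in> J_empty \<epsilon> (w ! (k mod length w))"
    and room: "\<And>i j. N \<le> i \<Longrightarrow> j \<le> r i * length w \<Longrightarrow> j + length w + l j \<le> i"
    and spell: "\<And>i. N \<le> i \<Longrightarrow> r i * length w \<le> i - N \<Longrightarrow>
      \<exists>b<r i. spelled u (int (i - (b + 1) * length w))"
  shows "renews u 0"
  unfolding renews_def
proof
  fix n show "alive u 0 n"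
  proof (induction n)
    case 0
    then show ?case by (auto simp: alive_def intro!: exI[of _ "[]"])
  next
    case (Suc n)
    then obtain s where s: "length s = n" "produces u 0 s" unfolding alive_def by blast
    have "\<exists>a. update (u (int n)) s = Some a"
    proof (cases "n < N")
      case True
      have "w ! (n mod length w) \<in> E" using w_pos by (intro w_regular) simp
      then show ?thesis using update_regular start[OF True] by blast
    next
      case False
      have "\<exists>j. j \<le> r n * length w \<and> j + length w \<le> n \<and> spelled u (int (n - j - length w))"
      proof (cases "r n * length w \<le> n - N")
        case True
        then obtain b where b: "b < r n" "spelled u (int (n - (b + 1) * length w))"
          using spell[of n] False by auto
        have "(b + 1) * length w \<le> r n * length w" using b(1) by (intro mult_le_mono1) simp
        then show ?thesis using b True by (intro exI[of _ "b * length w"]) (auto simp: algebra_simps)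
      next
        case long: False
        obtain R' where R': "R = Suc R'" using N(2) by (cases R) auto
        have "u (int (R' * length w + k)) \<in> J_empty \<epsilon> (w ! k)" if "k < length w" for k
          using start[of "R' * length w + k"] that by (simp add: N(1) R')
        then have "spelled u (int (R' * length w))" by (simp add: spelled_def)
        moreover have "n - (n - N) - length w = R' * length w" using False by (simp add: N(1) R')
        ultimately show ?thesis using long False
          by (intro exI[of _ "n - N"]) (auto simp: N(1) R')
      qed
      then obtain j where j: "j \<le> r n * length w" "j + length w \<le> n" "spelled u (int (n - j - length w))"
        by blast
      have "\<exists>v\<in>\<tau>. is_suffix v (Finite s)"
      proof (rule context_exists)
        show "set s \<subseteq> A" by (rule produces_subset[OF s(2)])
        show "j + length w \<le> length s" using j s by simp
        show "s ! (length s - j - length w + k) = w ! k" if "k < length w" for k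
        proof (rule produces_regular[OF s(2)])
          have "int (length s - j - length w + k) = int (n - j - length w) + int k" using s(1) by simp
          then show "u (int (length s - j - length w + k)) \<in> J_empty \<epsilon> (w ! k)"
            using j(3) that by (simp only: spelled_def)
        qed (use j that s w_regular in auto)
        show "m + length w + l m \<le> length s" if "m \<le> j" for m
          using room[of n m] that j(1) s(1) False by simp
      qed
      then show ?thesis using update_context unit by blast
    qed
    then obtain a where "update (u (int n)) s = Some a" ..
    then have "produces u 0 (s @ [a])" using s by (simp add: produces_snoc)
    then show ?case using s(1) unfolding alive_def by (intro exI[of _ "s @ [a]"]) simp
  qed
qed

lemma pred_spelled [measurable]: "Measurable.pred seqs (\<lambda>u. spelled u i)"
  unfolding spelled_def J_empty_def by measurable

lemma depends_spelled: "depends_on {i..<i + int (length w)} (\<lambda>u. spelled u i)"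
  unfolding depends_on_def spelled_def by auto

lemma ex_windows:
  "\<exists>r N0. (\<forall>i j. N0 \<le> i \<longrightarrow> j \<le> r i * length w \<longrightarrow> j + length w + l j \<le> i) \<and>
    summable (\<lambda>i. (1 - \<epsilon> ^ length w) ^ r i)"
proof -
  have "\<epsilon> ^ length w < 1" using eps_pos eps_less w_pos by (intro power_less_one_iff[THEN iffD2]) auto
  then have pos: "0 < 1 - \<epsilon> ^ length w" and "1 - \<epsilon> ^ length w < 1" using eps_pos by auto
  then have "ln (1 - \<epsilon> ^ length w) < 0" by simp
  then have C: "0 < C_const \<epsilon> w" using w_pos by (simp add: C_const_def field_simps)
  have "exp (- C_const \<epsilon> w * real (length w)) = 1 - \<epsilon> ^ length w"
    using w_pos pos by (simp add: C_const_def)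
  then show ?thesis using waiting_windows[OF C w_pos growth] by metis
qed

end

locale reference_chain = reference_tree A \<tau> p \<epsilon> w l + iid_sequence M U "uniform_measure lborel {0..<1}"
  for A \<tau> p \<epsilon> w l and M :: "'b measure" and U
begin

lemma pr_regular: "a \<in> E \<Longrightarrow> pr (\<lambda>u. u i \<in> J_empty \<epsilon> a) = \<epsilon>"
proof -
  assume "a \<in> E"
  then have a: "1 \<le> a" "a \<le> card E" by (auto simp: mem_E_iff)
  have "real a * \<epsilon> \<le> real (card E) * \<epsilon>" using a eps_pos by (intro mult_right_mono) auto
  then have "real a * \<epsilon> \<le> 1" using regular_mass_le by linarith
  moreover have "0 \<le> (real a - 1) * \<epsilon>" using a eps_pos by simp
  ultimately have sub: "{0..<1} \<inter> J_empty \<epsilon> a = J_empty \<epsilon> a" by (auto simp: J_empty_def)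
  have len: "(real a - 1) * \<epsilon> \<le> real a * \<epsilon>" using eps_pos by (intro mult_right_mono) auto
  have "pr (\<lambda>u. u i \<in> J_empty \<epsilon> a) = measure (distr M borel (U i)) (J_empty \<epsilon> a)"
    unfolding pr_def by (subst measure_distr[OF random_variable_U])
      (simp_all add: J_empty_def vimage_def Int_def conj_commute)
  also have "\<dots> = measure lborel ({0..<1} \<inter> J_empty \<epsilon> a) / measure lborel {0..<1::real}"
    unfolding distr_U by (subst measure_uniform_measure) (auto simp: J_empty_def)
  also have "\<dots> = \<epsilon>"
    unfolding sub using len by (simp add: J_empty_def algebra_simps)
  finally show ?thesis .
qed

lemma pr_regular_word:
  assumes "\<And>k. k < n \<Longrightarrow> x k \<in> E"
  shows "pr (\<lambda>u. \<forall>k\<in>{..<n}. u (i + int k) \<in> J_empty \<epsilon> (x k)) = \<epsilon> ^ n"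
proof -
  have "pr (\<lambda>u. \<forall>k\<in>{..<n}. u (i + int k) \<in> J_empty \<epsilon> (x k)) = (\<Prod>k\<in>{..<n}. pr (\<lambda>u. u (i + int k) \<in> J_empty \<epsilon> (x k)))"
  proof (rule pr_ball_indep[where I = "\<lambda>k. {i + int k}"])
    show "Measurable.pred seqs (\<lambda>u. u (i + int k) \<in> J_empty \<epsilon> (x k))" for k
      unfolding J_empty_def by measurable
  qed (auto simp: depends_on_def disjoint_family_on_def)
  also have "\<dots> = (\<Prod>k\<in>{..<n}. \<epsilon>)"
    using assms by (intro prod.cong pr_regular) auto
  finally show ?thesis by simp
qed

lemma pr_spelled: "pr (\<lambda>u. spelled u i) = \<epsilon> ^ length w"
  using pr_regular_word[of "length w" "\<lambda>k. w ! k" i] w_regular by (simp add: spelled_def Ball_def)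

text \<open>
  The blocks are disjoint, so the failures are independent.
\<close>

lemma pr_never_spelled:
  assumes "r * length w \<le> i"
  shows "pr (\<lambda>u. \<forall>b\<in>{..<r}. \<not> spelled u (int (i - (b + 1) * length w))) = (1 - \<epsilon> ^ length w) ^ r"
proof -
  define e where "e b = int i - int b * int (length w)" for b
  have start: "int (i - (b + 1) * length w) = e (Suc b)" if "b < r" for b
  proof -
    have "(b + 1) * length w \<le> r * length w" using that by (intro mult_le_mono1) simp
    then show ?thesis using assms by (simp add: e_def of_nat_diff algebra_simps)
  qed
  have e_anti: "e c \<le> e b" if "b \<le> c" for b c
    using that by (simp add: e_def mult_right_mono)
  have "pr (\<lambda>u. \<forall>b\<in>{..<r}. \<not> spelled u (int (i - (b + 1) * length w))) =
      (\<Prod>b\<in>{..<r}. pr (\<lambda>u. \<not> spelled u (int (i - (b + 1) * length w))))"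
  proof (rule pr_ball_indep[where I = "\<lambda>b. {e (Suc b)..<e b}"])
    fix b assume "b \<in> {..<r}"
    then have b: "int (i - (b + 1) * length w) = e (Suc b)" using start by simp
    have "e (Suc b) + int (length w) = e b" by (simp add: e_def algebra_simps)
    then show "depends_on {e (Suc b)..<e b} (\<lambda>u. \<not> spelled u (int (i - (b + 1) * length w)))"
      using depends_spelled[of "e (Suc b)"] unfolding b depends_on_def by simp
  next
    show "disjoint_family_on (\<lambda>b. {e (Suc b)..<e b}) {..<r}"
      unfolding disjoint_family_on_def
    proof (intro ballI impI)
      fix b c :: nat assume "b \<noteq> c"
      then have "Suc b \<le> c \<or> Suc c \<le> b" by linarith
      then show "{e (Suc b)..<e b} \<inter> {e (Suc c)..<e c} = {}" using e_anti by fastforce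
    qed
  qed auto
  also have "\<dots> = (\<Prod>b\<in>{..<r}. 1 - \<epsilon> ^ length w)"
    by (intro prod.cong refl) (simp add: pr_not pr_spelled)
  finally show ?thesis by simp
qed

lemma AE_unit: "AE \<omega> in M. \<forall>n. 0 \<le> U n \<omega> \<and> U n \<omega> < 1"
proof -
  have "AE x in uniform_measure lborel {0..<1::real}. 0 \<le> x \<and> x < 1"
    by (rule AE_uniform_measureI) auto
  then have law: "AE x in distr M borel (U n). 0 \<le> x \<and> x < 1" for n unfolding distr_U .
  have "AE \<omega> in M. 0 \<le> U n \<omega> \<and> U n \<omega> < 1" for n
    by (rule AE_distrD[OF random_variable_U law])
  then show ?thesis by (simp add: AE_all_countable)
qed

text \<open>
  Choose \<open>N\<close> so large that the failure probabilities from \<open>N\<close> on sum up to less than \<open>1\<close>. Spelling copies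
  of \<open>w\<close> up to time \<open>N\<close> has positive probability and concerns the noise before \<open>N\<close>; the failures
  \<open>bad i\<close> concern the noise from \<open>N\<close> on, because only windows that do not reach back before \<open>N\<close> are
  considered. Hence with positive probability the start succeeds and no failure ever occurs.
\<close>

lemma renewal_has_positive_probability: "0 < pr (\<lambda>u. renews u 0)"
proof -
  obtain r N0 where room: "\<And>i j. N0 \<le> i \<Longrightarrow> j \<le> r i * length w \<Longrightarrow> j + length w + l j \<le> i"
    and summable: "summable (\<lambda>i. (1 - \<epsilon> ^ length w) ^ r i)"
    using ex_windows by blast
  define h where "h i = (1 - \<epsilon> ^ length w) ^ r i" for i
  have h0: "0 \<le> h i" for i using eps_pos eps_less by (simp add: h_def power_le_one)
  obtain N1 where N1: "\<And>n. N1 \<le> n \<Longrightarrow> norm (\<Sum>i. h (i + n)) < 1"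
    using suminf_exist_split[of 1 h] summable by (auto simp: h_def[abs_def])
  define R where "R = N0 + N1 + 1"
  define N where "N = R * length w"
  have "R * 1 \<le> N" unfolding N_def using w_pos by (intro mult_le_mono2) linarith
  then have N: "N0 \<le> N" "N1 \<le> N" "0 < R" by (auto simp: R_def)
  define start where "start u \<longleftrightarrow> (\<forall>k\<in>{..<N}. u (0 + int k) \<in> J_empty \<epsilon> (w ! (k mod length w)))" for u :: "int \<Rightarrow> real"
  define bad where "bad i u \<longleftrightarrow> r i * length w \<le> i - N \<and> (\<forall>b\<in>{..<r i}. \<not> spelled u (int (i - (b + 1) * length w)))" for i u
  define Bad where "Bad u \<longleftrightarrow> (\<exists>i. bad (i + N) u)" for u
  have [measurable]: "Measurable.pred seqs start" unfolding start_def[abs_def] J_empty_def by measurable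
  have [measurable]: "Measurable.pred seqs (bad i)" for i unfolding bad_def[abs_def] by measurable
  have [measurable]: "Measurable.pred seqs Bad" unfolding Bad_def[abs_def] by measurable
  have pr_start: "pr start = \<epsilon> ^ N"
    unfolding start_def[abs_def] using w_regular w_pos by (intro pr_regular_word) auto
  have pr_bad: "pr (bad i) \<le> h i" for i
  proof (cases "r i * length w \<le> i - N")
    case True
    then show ?thesis using pr_never_spelled[of "r i" i] by (simp add: bad_def[abs_def] h_def)
  next
    case False
    then show ?thesis using h0 by (simp add: bad_def[abs_def] pr_def)
  qed
  have sum_h: "summable (\<lambda>i. h (i + N))" using summable unfolding h_def[abs_def] by (rule summable_ignore_initial_segment)
  have pr_Bad: "pr Bad < 1"
  proof -
    define B where "B i = {\<omega>\<in>space M. bad (i + N) (\<lambda>n. U n \<omega>)}" for i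
    have B: "prob (B i) \<le> h (i + N)" for i using pr_bad[of "i + N"] by (simp add: B_def pr_def)
    have sum_B: "summable (\<lambda>i. prob (B i))" by (rule summable_comparison_test'[OF sum_h]) (use B in auto)
    have "pr Bad = prob (\<Union>i. B i)"
      unfolding pr_def Bad_def B_def by (intro arg_cong[where f=prob]) auto
    also have "\<dots> \<le> (\<Sum>i. prob (B i))"
      by (intro finite_measure_subadditive_countably sum_B) (auto simp: B_def intro!: event_seq)
    also have "\<dots> \<le> (\<Sum>i. h (i + N))" by (intro suminf_le B sum_B sum_h)
    also have "\<dots> < 1" using N1[OF N(2)] by simp
    finally show ?thesis .
  qed
  have "pr (\<lambda>u. start u \<and> \<not> Bad u) = pr start * pr (\<lambda>u. \<not> Bad u)"
  proof (rule pr_indep)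
    show "depends_on {0..<int N} start" unfolding depends_on_def start_def by auto
    show "depends_on {int N..} (\<lambda>u. \<not> Bad u)"
    proof -
      have "bad i u = bad i v" if uv: "\<forall>n\<in>{int N..}. u n = v n" for i u v
      proof -
        have "spelled u (int (i - (b + 1) * length w)) = spelled v (int (i - (b + 1) * length w))"
          if "r i * length w \<le> i - N" "b < r i" for b
        proof -
          have "(b + 1) * length w \<le> r i * length w" using that by (intro mult_le_mono1) simp
          then have "(b + 1) * length w \<le> i - N" using that by linarith
          moreover have "0 < (b + 1) * length w" using w_pos by simp
          ultimately have "N \<le> i - (b + 1) * length w" by linarith
          then show ?thesis using uv by (intro depends_onD[OF depends_spelled]) auto
        qed
        then show ?thesis unfolding bad_def by blast
      qed
      then show ?thesis unfolding depends_on_def Bad_def by blast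
    qed
    show "{0..<int N} \<inter> {int N..} = {}" by auto
  qed measurable
  also have "\<dots> > 0" using pr_Bad eps_pos by (simp add: pr_start pr_not)
  also have "pr (\<lambda>u. start u \<and> \<not> Bad u) \<le> pr (\<lambda>u. renews u 0)"
    unfolding pr_def
  proof (rule finite_measure_mono_AE)
    show "AE \<omega> in M. \<omega> \<in> {\<omega>\<in>space M. start (\<lambda>n. U n \<omega>) \<and> \<not> Bad (\<lambda>n. U n \<omega>)} \<longrightarrow>
        \<omega> \<in> {\<omega>\<in>space M. renews (\<lambda>n. U n \<omega>) 0}"
      using AE_unit
    proof eventually_elim
      case (elim \<omega>)
      have "renews (\<lambda>n. U n \<omega>) 0" if start: "start (\<lambda>n. U n \<omega>)" and good: "\<not> Bad (\<lambda>n. U n \<omega>)"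
      proof (rule renews_from_spelling[OF N_def N(3)])
        show "U (int k) \<omega> \<in> J_empty \<epsilon> (w ! (k mod length w))" if "k < N" for k
          using start that by (auto simp: start_def)
        show "\<exists>b<r i. spelled (\<lambda>n. U n \<omega>) (int (i - (b + 1) * length w))"
          if "N \<le> i" "r i * length w \<le> i - N" for i
        proof -
          have "\<not> bad (i - N + N) (\<lambda>n. U n \<omega>)" using good by (auto simp: Bad_def)
          then show ?thesis using that by (auto simp: bad_def)
        qed
      qed (use elim room N(1) in auto)
      then show ?case by auto
    qed
  qed (auto intro!: event_seq)
  finally show ?thesis by simp
qed

end

section \<open>The regeneration scheme\<close>

theorem corollary5p2:
  fixes A :: "nat set" and \<tau> :: "nat str set" and p :: "nat str \<Rightarrow> nat pmf"
    and \<epsilon> :: real and w :: "nat list" and l :: "nat \<Rightarrow> nat"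
    and M :: "'b measure" and U :: "int \<Rightarrow> 'b \<Rightarrow> real"
  assumes pct: "prob_context_tree A \<tau> p"
    and unbounded: "unbounded_tree \<tau>"
    and eps: "0 < \<epsilon>" "\<epsilon> < 1"
    and labels: "labelled A (regular_symbols A \<tau> p \<epsilon>)"
    and regular: "regular_string A \<tau> p \<epsilon> w"
    and reference: "reference_string \<tau> w l"
    and growth: "limsup (\<lambda>k. elog (l k) / ereal (C_const \<epsilon> w * real k)) < 1"
    and prob: "prob_space M"
    and U_indep: "prob_space.indep_vars M (\<lambda>_. borel) U UNIV"
    and U_uniform: "\<And>n. distr M borel (U n) = uniform_measure lborel {0..<1}"
  defines "X \<equiv> \<lambda>j \<omega>. chain A \<tau> p \<epsilon> (\<lambda>n. U n \<omega>) j"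
    and "\<xi> \<equiv> \<lambda>j \<omega>. xi A \<tau> p \<epsilon> (\<lambda>n. U n \<omega>) j"
  defines "T \<equiv> \<lambda>i \<omega>. renewal_times (\<lambda>j. \<xi> j \<omega>) i"
  defines "S \<equiv> \<lambda>i \<omega>. map (\<lambda>j. X j \<omega>) [T i \<omega>..T (i + 1) \<omega> - 1]"
  shows "prob_space.renewal M \<xi> \<and>
    prob_space.indep_vars M (\<lambda>_. count_space UNIV) S {i. i \<noteq> 0} \<and>
    prob_space.ident_distr M {i. i \<noteq> 0} (count_space UNIV) S \<and>
    (\<forall>i. i \<noteq> 0 \<longrightarrow> integrable M (\<lambda>\<omega>. real (length (S i \<omega>))))"
proof -
  interpret prob_space M by (rule prob)
  interpret reference_chain A \<tau> p \<epsilon> w l M U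
    by unfold_locales (fact pct unbounded eps labels regular reference growth U_indep U_uniform)+
  interpret regenerative_sequence M U "uniform_measure lborel {0..<1}" update
    by unfold_locales (rule renewal_has_positive_probability)
  have xi: "\<xi> = (\<lambda>j \<omega>. if renews (\<lambda>n. U n \<omega>) j then 1 else 0)"
    by (simp add: \<xi>_def xi_eq fun_eq_iff)
  have S: "S = Cut"
    by (simp add: S_def T_def X_def xi renewal_times_eq chain_eq_symbol cut_def fun_eq_iff)
  have "indep_vars (\<lambda>_. count_space UNIV) Cut {i. i \<noteq> 0}"
    by (rule indep_vars_subset[OF indep_Cut]) simp
  then show ?thesis
    unfolding xi S using renewal_renews ident_distr_Cut integrable_length_Cut by blast
qed

end
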